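(* Let $0<\alpha<1$. (1) If $1<p<q\leq\infty$ satisfy $\frac1p-\frac1q=\alpha$, then the fractional maximal operator $M_\alpha:L^p_{\mathcal{K}}(\mathbb{R}^n,|\cdot|)\to L^q_{\mathcal{K}}(\mathbb{R}^n,|\cdot|)$ is bounded; that is, there is a constant $C$ such that $\lVert M_\alpha F\rVert_{L^q_{\mathcal{K}}(\mathbb{R}^n,|\cdot|)}\leq C\lVert F\rVert_{L^p_{\mathcal{K}}(\mathbb{R}^n,|\cdot|)}$ for all $F\in L^p_{\mathcal{K}}(\mathbb{R}^n,|\cdot|)$. (2) If $p=1$ and $q=\frac{1}{1-\alpha}$, then $M_\alpha:L^1_{\mathcal{K}}(\mathbb{R}^n,|\cdot|)\to L^{1/(1-\alpha),\infty}_{\mathcal{K}}(\mathbb{R}^n,|\cdot|)$ is bounded; that is, there is a constant $C$ such that $\lVert M_\alpha F\rVert_{L^{1/(1-\alpha),\infty}_{\mathcal{K}}(\mathbb{R}^n,|\cdot|)}\leq C\lVert F\rVert_{L^1_{\mathcal{K}}(\mathbb{R}^n,|\cdot|)}$ for all $F\in L^1_{\mathcal{K}}(\mathbb{R}^n,|\cdot|)$.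
   Context: $\mathcal{K}_{bcs}(\mathbb{R}^d)$ is the collection of all nonempty, closed, bounded, convex, symmetric ($-E=E$) subsets of $\mathbb{R}^d$. $\mathbb{R}^n$ carries Lebesgue measure $m_n$, and $|Q|=m_n(Q)$ for a cube $Q$. A function $F:\mathbb{R}^n\to\mathcal{K}_{bcs}(\mathbb{R}^d)$ is measurable if $\{x:F(x)\cap U\neq\emptyset\}$ is measurable for every open $U\subset\mathbb{R}^d$. It is locally integrably bounded if it is measurable and there is a non-negative $k\in L^1_{loc}(\mathbb{R}^n)$ such that $F(x)$ is contained in the ball $B(0,k(x))$ for a.e. $x$. For $E\subset\mathbb{R}^d$, $|E|=\sup_{v\in E}|v|$ (Euclidean norm). For $0<p<\infty$, $\lVert F\rVert_{L^p_{\mathcal{K}}(\mathbb{R}^n,|\cdot|)}=\left(\int_{\mathbb{R}^n}|F(x)|^p\,dx\right)^{1/p}$ and $\lVert F\rVert_{L^{p,\infty}_{\mathcal{K}}(\mathbb{R}^n,|\cdot|)}=\sup_{\lambda>0}\lambda\, m_n(\{x:|F(x)|>\lambda\})^{1/p}$; for $p=\infty$, $\lVert F\rVert_{L^\infty_{\mathcal{K}}(\mathbb{R}^n,|\cdot|)}=\operatorname{ess\,sup}_x|F(x)|$. The corresponding spaces consist of the measurable $\mathcal{K}_{bcs}(\mathbb{R}^d)$-valued functions for which these quantities are finite. The Aumann integral of $F$ over a cube $Q$ is $\int_Q F(y)\,dy=\left\{\int_Q f(y)\,dy: f\in L^1(Q,\mathbb{R}^d)\text{ measurable},\ f(y)\in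 F(y)\text{ for a.e. }y\in Q\right\}$. For locally integrably bounded $F$, the fractional averaging operator is $A_{Q,\alpha}F(x)=\frac{1}{|Q|^{1-\alpha}}\int_Q F(y)\,dy\cdot\chi_Q(x)$ (with $\lambda E=\{\lambda v:v\in E\}$, so the value is $\{0\}$ for $x\notin Q$), and the fractional maximal operator is $$M_\alpha F(x)=\overline{\mathrm{conv}}\left(\bigcup_Q A_{Q,\alpha}F(x)\right),$$ where the union is over all cubes $Q\subset\mathbb{R}^n$ with sides parallel to the coordinate axes and $\overline{\mathrm{conv}}$ denotes the closure of the convex hull. *)

theory Defs
  imports "HOL-Analysis.Analysis" "HOL-Probability.Essential_Supremum"
begin

definition Kbcs :: "(real ^ 'd) set set" where
  "Kbcs = {E. E \<noteq> {} \<and> closed E \<and> bounded E \<and> convex E \<and> uminus ` E = E}"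

definition Kmeasurable :: "(real ^ 'n \<Rightarrow> (real ^ 'd) set) \<Rightarrow> bool" where
  "Kmeasurable F \<longleftrightarrow> (\<forall>U. open U \<longrightarrow> {x. F x \<inter> U \<noteq> {}} \<in> sets lebesgue)"

text \<open>The magnitude of a set is extended-valued: it is infinite on unbounded sets, which
  the maximal operator may take as values on a null set.\<close>

definition set_norm :: "(real ^ 'd) set \<Rightarrow> ennreal" where
  "set_norm E = (SUP v\<in>E. ennreal (norm v))"

text \<open>Real powers of extended nonnegative reals; intended for exponents \<open>r > 0\<close> only.\<close>

definition ennpowr :: "ennreal \<Rightarrow> real \<Rightarrow> ennreal" where
  "ennpowr a r = (if a = \<infinity> then \<infinity> else ennreal (enn2real a powr r))"

definition LpK_norm :: "ereal \<Rightarrow> (real ^ 'n \<Rightarrow> (real ^ 'd) set) \<Rightarrow> ennreal" where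
  "LpK_norm p F =
     (if p = \<infinity> then esssup lebesgue (\<lambda>x. set_norm (F x))
      else ennpowr (\<integral>\<^sup>+ x. ennpowr (set_norm (F x)) (real_of_ereal p) \<partial>lebesgue)
             (1 / real_of_ereal p))"

definition weak_LpK_norm :: "real \<Rightarrow> (real ^ 'n \<Rightarrow> (real ^ 'd) set) \<Rightarrow> ennreal" where
  "weak_LpK_norm p F =
     (SUP l\<in>{0<..}. ennreal l * ennpowr (emeasure lebesgue {x. ennreal l < set_norm (F x)}) (1 / p))"

definition LpK :: "ereal \<Rightarrow> (real ^ 'n \<Rightarrow> (real ^ 'd) set) set" where
  "LpK p = {F. (\<forall>x. F x \<in> Kbcs) \<and> Kmeasurable F \<and> LpK_norm p F < \<infinity>}"

definition weak_LpK :: "real \<Rightarrow> (real ^ 'n \<Rightarrow> (real ^ 'd) set) set" where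
  "weak_LpK p = {F. (\<forall>x. F x \<in> Kbcs) \<and> Kmeasurable F \<and> weak_LpK_norm p F < \<infinity>}"

text \<open>Membership up to a null set. The value of the maximal operator at a point of a null set
  may be unbounded, hence outside \<^const>\<open>Kbcs\<close>, so its image lies in the target space only in
  the usual sense of functions identified almost everywhere.\<close>

definition ae_member ::
  "(real ^ 'n \<Rightarrow> (real ^ 'd) set) \<Rightarrow> (real ^ 'n \<Rightarrow> (real ^ 'd) set) set \<Rightarrow> bool" where
  "ae_member F X \<longleftrightarrow> (\<exists>G\<in>X. AE x in lebesgue. F x = G x)"

text \<open>Axis-parallel cubes are taken closed and nondegenerate.\<close>

definition cubes :: "(real ^ 'n) set set" where
  "cubes = {cbox a (\<chi> i. a $ i + h) | a h. 0 < h}"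

definition aumann_integral :: "(real ^ 'n) set \<Rightarrow> (real ^ 'n \<Rightarrow> (real ^ 'd) set) \<Rightarrow> (real ^ 'd) set"
  where
  "aumann_integral Q F =
     {set_lebesgue_integral lebesgue Q f | f.
        set_integrable lebesgue Q f \<and> (AE y in lebesgue. y \<in> Q \<longrightarrow> f y \<in> F y)}"

definition frac_avg ::
  "real \<Rightarrow> (real ^ 'n) set \<Rightarrow> (real ^ 'n \<Rightarrow> (real ^ 'd) set) \<Rightarrow> real ^ 'n \<Rightarrow> (real ^ 'd) set" where
  "frac_avg \<alpha> Q F x =
     (\<lambda>v. (1 / measure lebesgue Q powr (1 - \<alpha>) * indicator Q x) *\<^sub>R v) ` aumann_integral Q F"

definition frac_maximal ::
  "real \<Rightarrow> (real ^ 'n \<Rightarrow> (real ^ 'd) set) \<Rightarrow> real ^ 'n \<Rightarrow> (real ^ 'd) set" where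
  "frac_maximal \<alpha> F x = closure (convex hull (\<Union>Q\<in>cubes. frac_avg \<alpha> Q F x))"

end

theory Submission
  imports Defs
begin

text \<open>The magnitude of \<open>M\<^sub>\<alpha> F(x)\<close> is at most the scalar fractional maximal function of
  \<open>|F|\<close>, because closed balls are closed and convex. By Hedberg's inequality the latter is at
  most a power of the Hardy--Littlewood maximal function times a power of the norm of \<open>F\<close>, so the
  weak (1,1) and strong (p,p) bounds of the Hardy--Littlewood maximal function (a Vitali covering
  of compact sets and a layer-cake integral) give the norm inequalities. Measurability needs no
  measurable selection: the set of points \<open>x\<close> where \<open>M\<^sub>\<alpha> F(x)\<close> meets an open set is open.\<close>

section \<open>The Hardy--Littlewood maximal function over cubes\<close>

text \<open>With A the integral of |F| over a cube, N the L^p norm of |F| and H its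
  Hardy--Littlewood function, Hedberg's bound is a multiple of H^(1 - \<alpha> p) N^(\<alpha> p).
  The relation 1/p - 1/q = \<alpha> says exactly q (1 - \<alpha> p) = p, so the q-th power of the
  bound is a constant times H^p, and for p = 1 a level of H^(1 - \<alpha>) is a level of H. For q
  infinite, \<alpha> p = 1: H drops out, and a Hoelder bound on each cube suffices, which is why
  this endpoint is treated apart.

  Cubes are closed, so a point can lie on the boundary of the cube that witnesses a large average.
  The remedy is everywhere the same: enlarge the cube by a margin on all sides. A small margin
  changes the normalising power of |Q| by a factor near 1, which gives openness of level sets and
  lower semicontinuity. A margin equal to the side gives open covers of compact sets, at the price
  of the Vitali factor 5 instead of 3.

  The norm bounds do not make every value of \<open>frac_maximal\<close> bounded. Membership in the
  target space is obtained by resetting the unbounded values to {0}, which keeps measurability and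
  does not increase the norm.\<close>

definition cube :: "real ^ 'n \<Rightarrow> real \<Rightarrow> (real ^ 'n) set" where
  "cube a h = cbox a (\<chi> i. a $ i + h)"

text \<open>The parameter \<open>e\<close> is an absolute margin on each side, not a ratio: margin
  \<open>h\<close> gives the concentric cube of side 3h, margin \<open>2 * h\<close> the one of side
  5h.\<close>

definition expand_cube :: "real \<Rightarrow> real ^ 'n \<Rightarrow> real \<Rightarrow> (real ^ 'n) set" where
  "expand_cube e a h = cube (\<chi> i. a $ i - e) (h + 2 * e)"

lemma cubes_eq: "cubes = {cube a h | a h. 0 < h}"
  by (simp add: cubes_def cube_def)

lemma in_cubes [simp]: "0 < h \<Longrightarrow> cube a h \<in> cubes"
  by (auto simp: cubes_eq)

lemma mem_cube: "y \<in> cube a h \<longleftrightarrow> (\<forall>i. a $ i \<le> y $ i \<and> y $ i \<le> a $ i + h)"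
  by (simp add: cube_def mem_box_cart)

lemma cube_sets [measurable, simp]: "cube a h \<in> sets lebesgue"
  by (simp add: cube_def)

lemma measure_cube:
  fixes a :: "real ^ 'n"
  assumes "0 \<le> h"
  shows "measure lebesgue (cube a h) = h ^ CARD('n)"
proof -
  have "cbox a (\<chi> i. a $ i + h) \<noteq> {}"
    using assms by (auto simp: interval_ne_empty_cart(1))
  then show ?thesis
    by (simp add: cube_def content_cbox_cart)
qed

lemma emeasure_cube:
  fixes a :: "real ^ 'n"
  assumes "0 \<le> h"
  shows "emeasure lebesgue (cube a h) = ennreal (h ^ CARD('n))"
  using measure_cube[OF assms, of a] emeasure_eq_ennreal_measure[of lebesgue "cube a h"]
    emeasure_lborel_cbox_finite[of a "\<chi> i. a $ i + h"]
  by (simp add: cube_def less_top)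

lemma mem_expand_cube:
  "y \<in> expand_cube e a h \<longleftrightarrow> (\<forall>i. a $ i - e \<le> y $ i \<and> y $ i \<le> a $ i + h + e)"
  unfolding expand_cube_def mem_cube by (auto simp: algebra_simps)

lemma eventually_mem_expand_cube:
  assumes "x \<in> cube a h" "0 < e"
  shows "\<forall>\<^sub>F y in nhds x. y \<in> expand_cube e a h"
proof -
  let ?U = "box (\<chi> i. a $ i - e) (\<chi> i. a $ i + h + e)"
  have "open ?U" by (rule open_box)
  moreover have "x \<in> ?U"
    unfolding mem_box_cart
  proof
    fix i
    have "a $ i \<le> x $ i" "x $ i \<le> a $ i + h"
      using assms(1) by (simp_all add: mem_cube)
    then show "(\<chi> i. a $ i - e) $ i < x $ i \<and> x $ i < (\<chi> i. a $ i + h + e) $ i"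
      using assms(2) by simp
  qed
  moreover have "?U \<subseteq> expand_cube e a h"
    by (auto simp: mem_expand_cube mem_box_cart less_imp_le)
  ultimately show ?thesis
    unfolding eventually_nhds by (intro exI[of _ ?U]) blast
qed

lemma cube_subset_expand_cube:
  assumes "0 \<le> e"
  shows "cube a h \<subseteq> expand_cube e a h"
proof
  fix y assume y: "y \<in> cube a h"
  show "y \<in> expand_cube e a h"
    unfolding mem_expand_cube
  proof
    fix i
    have "a $ i \<le> y $ i" "y $ i \<le> a $ i + h"
      using y by (simp_all add: mem_cube)
    then show "a $ i - e \<le> y $ i \<and> y $ i \<le> a $ i + h + e"
      using assms by simp
  qed
qed

section \<open>The maximal function and its open level sets\<close>

definition hl_maximal :: "(real ^ 'n \<Rightarrow> ennreal) \<Rightarrow> real ^ 'n \<Rightarrow> ennreal" where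
  "hl_maximal g x =
     (SUP Q\<in>{Q \<in> cubes. x \<in> Q}. (\<integral>\<^sup>+ y\<in>Q. g y \<partial>lebesgue) / ennreal (measure lebesgue Q))"

lemma ennreal_less_divide_iff:
  assumes "0 \<le> t" "0 < m"
  shows "ennreal t < A / ennreal m \<longleftrightarrow> ennreal (t * m) < A"
proof (cases A)
  case (real r)
  then show ?thesis
    using assms by (simp add: divide_ennreal ennreal_less_iff field_simps)
next
  case top
  then show ?thesis using assms by (simp add: ennreal_top_divide)
qed

text \<open>Strictness gives an actual witness cube for the supremum, and clearing the denominator
  avoids division of extended reals in all level-set arguments.\<close>

lemma less_hl_maximal_iff:
  fixes g :: "real ^ 'n \<Rightarrow> ennreal"
  assumes "0 \<le> t"
  shows "ennreal t < hl_maximal g x \<longleftrightarrow>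
    (\<exists>a h. 0 < h \<and> x \<in> cube a h \<and> ennreal (t * h ^ CARD('n)) < (\<integral>\<^sup>+ y\<in>cube a h. g y \<partial>lebesgue))"
proof -
  have "ennreal t < hl_maximal g x \<longleftrightarrow>
      (\<exists>Q\<in>cubes. x \<in> Q \<and> ennreal t < (\<integral>\<^sup>+ y\<in>Q. g y \<partial>lebesgue) / ennreal (measure lebesgue Q))"
    by (simp add: hl_maximal_def less_SUP_iff conj_assoc Bex_def)
  also have "\<dots> \<longleftrightarrow> (\<exists>a h. 0 < h \<and> x \<in> cube a h \<and>
      ennreal t < (\<integral>\<^sup>+ y\<in>cube a h. g y \<partial>lebesgue) / ennreal (measure lebesgue (cube a h)))"
    unfolding cubes_eq by blast
  also have "\<dots> \<longleftrightarrow> (\<exists>a h. 0 < h \<and> x \<in> cube a h \<and>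
      ennreal (t * h ^ CARD('n)) < (\<integral>\<^sup>+ y\<in>cube a h. g y \<partial>lebesgue))"
    using assms by (intro ex_cong1 conj_cong refl) (simp add: measure_cube ennreal_less_divide_iff)
  finally show ?thesis .
qed

lemma cube_integral_le_hl_maximal:
  fixes g :: "real ^ 'n \<Rightarrow> ennreal"
  assumes "0 < h" "x \<in> cube a h"
  shows "(\<integral>\<^sup>+ y\<in>cube a h. g y \<partial>lebesgue) \<le> ennreal (h ^ CARD('n)) * hl_maximal g x"
proof -
  let ?A = "\<integral>\<^sup>+ y\<in>cube a h. g y \<partial>lebesgue"
  have "?A / ennreal (h ^ CARD('n)) \<le> hl_maximal g x"
    unfolding hl_maximal_def using assms by (intro SUP_upper2[of "cube a h"]) (auto simp: measure_cube)
  then have "ennreal (h ^ CARD('n)) * (?A / ennreal (h ^ CARD('n))) \<le> ennreal (h ^ CARD('n)) * hl_maximal g x"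
    by (rule mult_left_mono) simp
  then show ?thesis
    using assms by (simp add: ennreal_times_divide mult.commute[of "ennreal (h ^ CARD('n))"] ennreal_mult_divide_eq)
qed

text \<open>A strict inequality leaves room for a small margin \<open>e\<close>; the argument
  \<open>h + 2 * e\<close> is the side of the expanded cube.\<close>

lemma exists_expansion_less:
  fixes A :: ennreal and \<phi> :: "real \<Rightarrow> real"
  assumes cont: "isCont \<phi> h" and less: "ennreal (\<phi> h) < A"
  shows "\<exists>e>0. ennreal (\<phi> (h + 2 * e)) < A"
proof -
  have "((\<lambda>e. ennreal (\<phi> (h + 2 * e))) \<longlongrightarrow> ennreal (\<phi> h)) (at_right 0)"
    by (intro tendsto_ennrealI isCont_tendsto_compose[OF cont] tendsto_eq_intros refl) auto
  then have "\<forall>\<^sub>F e in at_right 0. ennreal (\<phi> (h + 2 * e)) < A"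
    using less by (rule order_tendstoD)
  then have "\<forall>\<^sub>F e in at_right 0. 0 < e \<and> ennreal (\<phi> (h + 2 * e)) < A"
    using eventually_at_right_less[of "0::real"] by (rule eventually_conj[rotated])
  then show ?thesis
    using eventually_happens'[OF trivial_limit_at_right_real] by blast
qed

text \<open>A witness cube for x is expanded slightly: the integral does not decrease, the volume
  grows little enough to keep the strict inequality, and the new cube is a witness for a whole
  neighbourhood of x.\<close>

lemma open_hl_maximal:
  fixes g :: "real ^ 'n \<Rightarrow> ennreal"
  assumes "0 \<le> t"
  shows "open {x. ennreal t < hl_maximal g x}"
proof -
  have "\<forall>\<^sub>F y in nhds x. y \<in> {x. ennreal t < hl_maximal g x}" if "ennreal t < hl_maximal g x" for x
  proof -
    obtain a h where h: "0 < h" "x \<in> cube a h"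
      and less: "ennreal (t * h ^ CARD('n)) < (\<integral>\<^sup>+ y\<in>cube a h. g y \<partial>lebesgue)"
      using \<open>ennreal t < hl_maximal g x\<close> less_hl_maximal_iff[OF assms] by blast
    obtain e where e: "0 < e" "ennreal (t * (h + 2 * e) ^ CARD('n)) < (\<integral>\<^sup>+ y\<in>cube a h. g y \<partial>lebesgue)"
      using exists_expansion_less[of h "\<lambda>h. t * h ^ CARD('n)", OF _ less] by (auto intro!: continuous_intros)
    have "(\<integral>\<^sup>+ y\<in>cube a h. g y \<partial>lebesgue) \<le> (\<integral>\<^sup>+ y\<in>expand_cube e a h. g y \<partial>lebesgue)"
      using e(1) cube_subset_expand_cube[of e a h]
      by (intro nn_integral_mono mult_left_mono) (auto simp: indicator_def)
    then have "ennreal t < hl_maximal g y" if "y \<in> expand_cube e a h" for y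
      using that e h unfolding less_hl_maximal_iff[OF assms] expand_cube_def
      by (intro exI[of _ "\<chi> i. a $ i - e"] exI[of _ "h + 2 * e"]) auto
    then show ?thesis
      using eventually_mem_expand_cube[OF h(2) e(1)] by (auto elim: eventually_mono)
  qed
  then show ?thesis
    unfolding open_contains_ball eventually_nhds_metric by (auto simp: subset_iff dist_commute)
qed

lemma borel_measurable_hl_maximal [measurable]:
  fixes g :: "real ^ 'n \<Rightarrow> ennreal"
  shows "hl_maximal g \<in> borel_measurable lebesgue"
proof (rule borel_measurableI_greater)
  fix y :: ennreal
  show "{x \<in> space lebesgue. y < hl_maximal g x} \<in> sets lebesgue"
  proof (cases y)
    case (real r)
    then show ?thesis using open_hl_maximal[of r g] by simp
  qed simp
qed

section \<open>Vitali covering and the weak (1,1) bound\<close>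

text \<open>Greedy selection: keep an index of largest \<open>r\<close>, discard all sets that meet
  it, and recurse on the rest. Nonemptiness makes the chosen set meet itself, so the index set
  strictly shrinks.\<close>

lemma finite_Vitali_covering:
  fixes C :: "'i \<Rightarrow> 'a set" and r :: "'i \<Rightarrow> real"
  assumes "finite I" "\<And>i. i \<in> I \<Longrightarrow> C i \<noteq> {}"
  shows "\<exists>J\<subseteq>I. disjoint_family_on C J \<and> (\<forall>i\<in>I. \<exists>j\<in>J. r i \<le> r j \<and> C i \<inter> C j \<noteq> {})"
  using assms
proof (induction "card I" arbitrary: I rule: less_induct)
  case less
  show ?case
  proof (cases "I = {}")
    case True
    then show ?thesis by (auto simp: disjoint_family_on_def)
  next
    case False
    then have "Max (r ` I) \<in> r ` I"
      using less.prems(1) by (intro Max_in) auto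
    then obtain m where m: "m \<in> I" "r m = Max (r ` I)" by auto
    have max: "r i \<le> r m" if "i \<in> I" for i
      unfolding m(2) using that less.prems(1) by (intro Max_ge) auto
    define I' where "I' = {i \<in> I. C i \<inter> C m = {}}"
    have "I' \<subset> I" using m less.prems(2)[OF m(1)] by (auto simp: I'_def)
    then have fin: "finite I'" and "card I' < card I"
      using less.prems(1) by (auto intro: psubset_card_mono finite_subset)
    then obtain J where J: "J \<subseteq> I'" "disjoint_family_on C J"
      "\<forall>i\<in>I'. \<exists>j\<in>J. r i \<le> r j \<and> C i \<inter> C j \<noteq> {}"
      using less.hyps[of I'] less.prems(2) by (auto simp: I'_def)
    show ?thesis
    proof (intro exI[of _ "insert m J"] conjI ballI)
      show "insert m J \<subseteq> I" using J(1) m(1) \<open>I' \<subset> I\<close> by blast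
      show "disjoint_family_on C (insert m J)"
        using J(1,2) unfolding disjoint_family_on_def I'_def by fast
    next
      fix i assume "i \<in> I"
      then show "\<exists>j\<in>insert m J. r i \<le> r j \<and> C i \<inter> C j \<noteq> {}"
        using J(3) max by (cases "i \<in> I'") (auto simp: I'_def)
    qed
  qed
qed

text \<open>From a common point z, every point of the threefold smaller cube is within 2h of z in
  each coordinate, hence within 2k of the larger cube. This is the origin of the factor 5.\<close>

lemma expand_cube_subset:
  assumes "cube a h \<inter> cube b k \<noteq> {}" "h \<le> k" "0 \<le> h"
  shows "expand_cube h a h \<subseteq> expand_cube (2 * k) b k"
proof
  obtain z where z: "z \<in> cube a h" "z \<in> cube b k" using assms(1) by blast
  fix y assume y: "y \<in> expand_cube h a h"
  show "y \<in> expand_cube (2 * k) b k"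
    unfolding mem_expand_cube
  proof
    fix i
    have "a $ i \<le> z $ i" "z $ i \<le> a $ i + h" "b $ i \<le> z $ i" "z $ i \<le> b $ i + k"
      "a $ i - h \<le> y $ i" "y $ i \<le> a $ i + h + h"
      using y z by (simp_all add: mem_expand_cube mem_cube)
    then show "b $ i - 2 * k \<le> y $ i \<and> y $ i \<le> b $ i + k + 2 * k"
      using assms by simp
  qed
qed

lemma sum_set_nn_integral_disjoint_le:
  assumes "finite J" "disjoint_family_on Q J" "g \<in> borel_measurable M" "\<And>j. j \<in> J \<Longrightarrow> Q j \<in> sets M"
  shows "(\<Sum>j\<in>J. \<integral>\<^sup>+ y\<in>Q j. g y \<partial>M) \<le> (\<integral>\<^sup>+ y. g y \<partial>M)"
proof -
  have "(\<Sum>j\<in>J. \<integral>\<^sup>+ y\<in>Q j. g y \<partial>M) = (\<integral>\<^sup>+ y. (\<Sum>j\<in>J. g y * indicator (Q j) y) \<partial>M)"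
    using assms by (intro nn_integral_sum[symmetric]) auto
  also have "\<dots> = (\<integral>\<^sup>+ y. g y * indicator (\<Union>j\<in>J. Q j) y \<partial>M)"
    using assms by (simp add: indicator_UN_disjoint sum_distrib_left)
  also have "\<dots> \<le> (\<integral>\<^sup>+ y. g y \<partial>M)"
    by (intro nn_integral_mono) (auto simp: indicator_def)
  finally show ?thesis .
qed

lemma hl_maximal_compact_bound:
  fixes g :: "real ^ 'n \<Rightarrow> ennreal"
  assumes g: "g \<in> borel_measurable lebesgue" and t: "0 < t"
    and K: "compact K" "K \<subseteq> {x. ennreal t < hl_maximal g x}"
  shows "ennreal t * emeasure lebesgue K \<le> 5 ^ CARD('n) * (\<integral>\<^sup>+ y. g y \<partial>lebesgue)"
proof -
  have "\<exists>a h. 0 < h \<and> x \<in> cube a h \<and>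
      ennreal (t * h ^ CARD('n)) < (\<integral>\<^sup>+ y\<in>cube a h. g y \<partial>lebesgue)" if "x \<in> K" for x
    using that K(2) t less_hl_maximal_iff[of t g x] by auto
  then obtain a h where ah: "\<And>x. x \<in> K \<Longrightarrow> 0 < h x \<and> x \<in> cube (a x) (h x) \<and>
      ennreal (t * h x ^ CARD('n)) < (\<integral>\<^sup>+ y\<in>cube (a x) (h x). g y \<partial>lebesgue)"
    by metis
  \<comment> \<open>The closed witness cubes need not be neighbourhoods of their points, so
    compactness is applied to open sets inside their threefold expansions; disjointness is still
    asked of the original cubes.\<close>
  have "\<exists>U. open U \<and> x \<in> U \<and> U \<subseteq> expand_cube (h x) (a x) (h x)" if "x \<in> K" for x
    using eventually_mem_expand_cube[of x "a x" "h x" "h x"] ah[OF that] unfolding eventually_nhds by blast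
  then obtain U where U: "\<And>x. x \<in> K \<Longrightarrow> open (U x) \<and> x \<in> U x \<and> U x \<subseteq> expand_cube (h x) (a x) (h x)"
    by metis
  obtain I where I: "I \<subseteq> K" "finite I" "K \<subseteq> (\<Union>x\<in>I. U x)"
    using compactE_image[OF K(1), of K U] U by blast
  obtain J where J: "J \<subseteq> I" "disjoint_family_on (\<lambda>x. cube (a x) (h x)) J"
    and cover: "\<And>i. i \<in> I \<Longrightarrow> \<exists>j\<in>J. h i \<le> h j \<and> cube (a i) (h i) \<inter> cube (a j) (h j) \<noteq> {}"
    using finite_Vitali_covering[OF I(2), of "\<lambda>x. cube (a x) (h x)" h] ah I(1) by blast
  have JK: "j \<in> K" if "j \<in> J" for j using that J(1) I(1) by blast
  have fin: "finite J" using J(1) I(2) finite_subset by blast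
  have "K \<subseteq> (\<Union>j\<in>J. expand_cube (2 * h j) (a j) (h j))"
  proof
    fix x assume "x \<in> K"
    then obtain i where i: "i \<in> I" "x \<in> expand_cube (h i) (a i) (h i)"
      using I U by blast
    obtain j where j: "j \<in> J" "h i \<le> h j" "cube (a i) (h i) \<inter> cube (a j) (h j) \<noteq> {}"
      using cover[OF i(1)] by blast
    have "0 \<le> h i" using ah[of i] I(1) i(1) by auto
    then show "x \<in> (\<Union>j\<in>J. expand_cube (2 * h j) (a j) (h j))"
      using expand_cube_subset[OF j(3,2)] i(2) j(1) by blast
  qed
  then have "emeasure lebesgue K \<le> emeasure lebesgue (\<Union>j\<in>J. expand_cube (2 * h j) (a j) (h j))"
    using fin by (intro emeasure_mono) (auto simp: expand_cube_def)
  also have "\<dots> \<le> (\<Sum>j\<in>J. emeasure lebesgue (expand_cube (2 * h j) (a j) (h j)))"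
    using fin by (intro emeasure_subadditive_finite) (auto simp: expand_cube_def)
  also have "\<dots> = (\<Sum>j\<in>J. 5 ^ CARD('n) * ennreal (h j ^ CARD('n)))"
  proof (intro sum.cong refl)
    fix j assume "j \<in> J"
    then have "0 < h j" using ah JK by blast
    then have "emeasure lebesgue (expand_cube (2 * h j) (a j) (h j)) = ennreal ((5 * h j) ^ CARD('n))"
      using emeasure_cube[of "5 * h j" "\<chi> i. a j $ i - 2 * h j"] by (simp add: expand_cube_def)
    also have "\<dots> = 5 ^ CARD('n) * ennreal (h j ^ CARD('n))"
      using \<open>0 < h j\<close> ennreal_power[of 5 "CARD('n)"]
      by (simp only: power_mult_distrib ennreal_mult zero_le_power less_imp_le zero_le_numeral ennreal_numeral)
    finally show "emeasure lebesgue (expand_cube (2 * h j) (a j) (h j)) = 5 ^ CARD('n) * ennreal (h j ^ CARD('n))" .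
  qed
  finally have "ennreal t * emeasure lebesgue K \<le> ennreal t * (\<Sum>j\<in>J. 5 ^ CARD('n) * ennreal (h j ^ CARD('n)))"
    by (rule mult_left_mono) simp
  also have "\<dots> = 5 ^ CARD('n) * (\<Sum>j\<in>J. ennreal (t * h j ^ CARD('n)))"
    unfolding sum_distrib_left
  proof (intro sum.cong refl)
    fix j assume "j \<in> J"
    then have "0 < h j" using ah JK by blast
    then show "ennreal t * (5 ^ CARD('n) * ennreal (h j ^ CARD('n))) = 5 ^ CARD('n) * ennreal (t * h j ^ CARD('n))"
      using t by (simp only: ennreal_mult zero_le_power less_imp_le mult.left_commute)
  qed
  also have "\<dots> \<le> 5 ^ CARD('n) * (\<Sum>j\<in>J. \<integral>\<^sup>+ y\<in>cube (a j) (h j). g y \<partial>lebesgue)"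
    using ah JK by (intro mult_left_mono sum_mono) (auto intro: less_imp_le)
  also have "\<dots> \<le> 5 ^ CARD('n) * (\<integral>\<^sup>+ y. g y \<partial>lebesgue)"
    using fin J(2) g by (intro mult_left_mono sum_set_nn_integral_disjoint_le) auto
  finally show ?thesis .
qed

text \<open>The level set is open, hence an increasing union of compact sets, and the bound for
  compact sets does not depend on the set.\<close>

lemma hl_maximal_weak_bound:
  fixes g :: "real ^ 'n \<Rightarrow> ennreal"
  assumes g: "g \<in> borel_measurable lebesgue" and t: "0 < t"
  shows "ennreal t * emeasure lebesgue {x. ennreal t < hl_maximal g x}
    \<le> 5 ^ CARD('n) * (\<integral>\<^sup>+ y. g y \<partial>lebesgue)"
proof -
  let ?O = "{x. ennreal t < hl_maximal g x}"
  obtain C where C: "\<And>n. compact (C n)" "\<And>n. C n \<subseteq> ?O" "\<And>n. C n \<subseteq> interior (C (Suc n))"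
    "\<Union>(range C) = ?O"
    using open_Union_compact_subsets[OF open_hl_maximal[of t g]] t by (metis less_imp_le)
  have "incseq C"
    using C(3) interior_subset by (intro incseq_SucI) blast
  moreover have "range C \<subseteq> sets lebesgue"
    using C(1) by (auto intro: lmeasurable_compact fmeasurableD)
  ultimately have "emeasure lebesgue ?O = (SUP n. emeasure lebesgue (C n))"
    using SUP_emeasure_incseq[of C lebesgue] C(4) by simp
  then have "ennreal t * emeasure lebesgue ?O = (SUP n. ennreal t * emeasure lebesgue (C n))"
    by (simp add: SUP_mult_left_ennreal)
  also have "\<dots> \<le> 5 ^ CARD('n) * (\<integral>\<^sup>+ y. g y \<partial>lebesgue)"
    using C hl_maximal_compact_bound[OF g t] by (intro SUP_least) blast
  finally show ?thesis .
qed

section \<open>The strong bound by layer-cake integration\<close>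

lemma sigma_finite_lebesgue: "sigma_finite_measure (lebesgue :: 'a::euclidean_space measure)"
proof
  obtain A :: "'a set set" where "countable A" "A \<subseteq> sets lborel" "\<Union>A = space lborel"
    "\<forall>a\<in>A. emeasure lborel a \<noteq> \<infinity>"
    using lborel.sigma_finite_countable by blast
  then show "\<exists>A::'a set set. countable A \<and> A \<subseteq> sets lebesgue \<and> \<Union>A = space lebesgue \<and>
      (\<forall>a\<in>A. emeasure lebesgue a \<noteq> \<infinity>)"
    by (intro exI[of _ A]) auto
qed

text \<open>The layer-cake formula at a single value. It is used with exponent p to unfold the power
  of the maximal function and with exponent p - 1 to fold the power of \<open>g\<close>
  back.\<close>

lemma ennpowr_eq_nn_integral:
  assumes "0 < p"
  shows "(\<integral>\<^sup>+ t\<in>{t. 0 < t \<and> ennreal t < a}. ennreal (p * t powr (p - 1)) \<partial>lborel) = ennpowr a p"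
    (is "?I a = _")
proof -
  have fin: "?I (ennreal c) = ennreal (c powr p)" if "0 \<le> c" for c
  proof -
    have "((\<lambda>t. p * t powr (p - 1)) has_integral p * (c powr (p - 1 + 1) / (p - 1 + 1))) {0..c}"
      using assms that by (intro has_integral_mult_right has_integral_powr_from_0) auto
    then have "((\<lambda>t. p * t powr (p - 1)) has_integral c powr p) {0<..<c}"
      using assms by (simp add: has_integral_Icc_iff_Ioo)
    then have "(\<integral>\<^sup>+ t\<in>{0<..<c}. ennreal (p * t powr (p - 1)) \<partial>lborel) = ennreal (c powr p)"
      using assms by (intro nn_integral_has_integral_lebesgue') auto
    moreover have "{t. 0 < t \<and> ennreal t < ennreal c} = {0<..<c}"
      by (auto simp: ennreal_less_iff)
    ultimately show ?thesis by simp
  qed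
  show ?thesis
  proof (cases a)
    case (real c)
    then show ?thesis using fin[of c] by (simp add: ennpowr_def)
  next
    case top
    \<comment> \<open>The integral for an infinite value dominates the one for the finite value
      N^(1/p), which is N by the finite case; N is arbitrary.\<close>
    have "ennreal (real N) \<le> ?I a" for N
    proof -
      have "ennreal (real N) = ?I (ennreal (real N powr (1 / p)))"
        using assms by (subst fin) (auto simp: powr_powr)
      also have "\<dots> \<le> ?I a"
        by (intro nn_integral_mono mult_left_mono) (auto simp: indicator_def top)
      finally show ?thesis .
    qed
    then have "(SUP N. of_nat N :: ennreal) \<le> ?I a"
      by (intro SUP_least) (simp add: ennreal_of_nat_eq_real_of_nat)
    then have "?I a = top"
      by (simp add: ennreal_SUP_of_nat_eq_top top_unique)
    then show ?thesis by (simp add: ennpowr_def top)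
  qed
qed

text \<open>The part of \<open>g\<close> not exceeding t/2 adds at most t/2 to any average, so an
  average above t owes more than t/2 to the rest.\<close>

lemma hl_maximal_truncate:
  fixes g :: "real ^ 'n \<Rightarrow> ennreal"
  assumes g: "g \<in> borel_measurable lebesgue" and t: "0 < t" and less: "ennreal t < hl_maximal g x"
  shows "ennreal (t / 2) < hl_maximal (\<lambda>y. g y * indicator {y. ennreal (t / 2) < g y} y) x"
proof -
  let ?g = "\<lambda>y. g y * indicator {y. ennreal (t / 2) < g y} y"
  obtain a h where h: "0 < h" "x \<in> cube a h"
    and lt: "ennreal (t * h ^ CARD('n)) < (\<integral>\<^sup>+ y\<in>cube a h. g y \<partial>lebesgue)"
    using less less_hl_maximal_iff[of t g x] t by auto
  have "{y. ennreal (t / 2) < g y} \<in> sets lebesgue"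
    using borel_measurable_less[OF borel_measurable_const[of "ennreal (t / 2)"] g]
    by simp
  then have meas: "?g \<in> borel_measurable lebesgue"
    using g by (intro borel_measurable_times_ennreal borel_measurable_indicator) auto
  \<comment> \<open>Arguing by contradiction adds two halves and so avoids subtracting extended
    reals.\<close>
  have "ennreal (t / 2 * h ^ CARD('n)) < (\<integral>\<^sup>+ y\<in>cube a h. ?g y \<partial>lebesgue)"
  proof (rule ccontr)
    assume "\<not> ?thesis"
    then have le: "(\<integral>\<^sup>+ y\<in>cube a h. ?g y \<partial>lebesgue) \<le> ennreal (t / 2 * h ^ CARD('n))" by simp
    have "(\<integral>\<^sup>+ y\<in>cube a h. g y \<partial>lebesgue)
        \<le> (\<integral>\<^sup>+ y. ?g y * indicator (cube a h) y + ennreal (t / 2) * indicator (cube a h) y \<partial>lebesgue)"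
      by (intro nn_integral_mono) (auto simp: indicator_def)
    also have "\<dots> = (\<integral>\<^sup>+ y\<in>cube a h. ?g y \<partial>lebesgue) + (\<integral>\<^sup>+ y\<in>cube a h. ennreal (t / 2) \<partial>lebesgue)"
      using meas by (intro nn_integral_add) auto
    also have "(\<integral>\<^sup>+ y\<in>cube a h. ennreal (t / 2) \<partial>lebesgue) = ennreal (t / 2 * h ^ CARD('n))"
      using t h emeasure_cube[of h a] nn_integral_cmult_indicator[OF cube_sets, of "ennreal (t / 2)" a h]
      by (simp only: ennreal_mult zero_le_power less_imp_le half_gt_zero)
    also have "(\<integral>\<^sup>+ y\<in>cube a h. ?g y \<partial>lebesgue) + ennreal (t / 2 * h ^ CARD('n))
        \<le> ennreal (t / 2 * h ^ CARD('n)) + ennreal (t / 2 * h ^ CARD('n))"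
      using le by (rule add_right_mono)
    also have "\<dots> = ennreal (t * h ^ CARD('n))"
      using t h by (subst ennreal_plus[symmetric]) auto
    finally show False using lt by simp
  qed
  then show ?thesis
    using h t less_hl_maximal_iff[of "t / 2" ?g x] by auto
qed

text \<open>The weak (1,1) bound is applied to the truncation at level t/2; rewriting t as 2 (t/2)
  costs the extra factor 2. The truncation makes the right-hand side integrable in t against the
  layer-cake weight.\<close>

lemma hl_maximal_distribution_bound:
  fixes g :: "real ^ 'n \<Rightarrow> ennreal"
  assumes g: "g \<in> borel_measurable lebesgue" and t: "0 < t"
  shows "ennreal t * emeasure lebesgue {x. ennreal t < hl_maximal g x}
    \<le> 2 * 5 ^ CARD('n) * (\<integral>\<^sup>+ y. g y * indicator {y. ennreal (t / 2) < g y} y \<partial>lebesgue)"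
proof -
  let ?g = "\<lambda>y. g y * indicator {y. ennreal (t / 2) < g y} y"
  have "{y. ennreal (t / 2) < g y} \<in> sets lebesgue"
    using borel_measurable_less[OF borel_measurable_const[of "ennreal (t / 2)"] g]
    by simp
  then have meas: "?g \<in> borel_measurable lebesgue"
    using g by (intro borel_measurable_times_ennreal borel_measurable_indicator) auto
  have "ennreal t * emeasure lebesgue {x. ennreal t < hl_maximal g x}
      \<le> ennreal t * emeasure lebesgue {x. ennreal (t / 2) < hl_maximal ?g x}"
    using hl_maximal_truncate[OF g t] t open_hl_maximal[of "t / 2" ?g]
    by (intro mult_left_mono emeasure_mono) auto
  also have "\<dots> = 2 * (ennreal (t / 2) * emeasure lebesgue {x. ennreal (t / 2) < hl_maximal ?g x})"
    using t ennreal_mult[of 2 "t / 2"] by (simp add: mult.assoc[symmetric])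
  also have "\<dots> \<le> 2 * (5 ^ CARD('n) * (\<integral>\<^sup>+ y. ?g y \<partial>lebesgue))"
    using t by (intro mult_left_mono hl_maximal_weak_bound[OF meas]) auto
  finally show ?thesis by (simp only: mult.assoc)
qed

lemma ennpowr_borel_measurable [measurable]: "(\<lambda>a. ennpowr a p) \<in> borel_measurable borel"
  unfolding ennpowr_def by measurable

text \<open>Marcinkiewicz interpolation between weak (1,1) and the trivial bound at infinity,
  carried out by hand: layer cake, Fubini, the truncated weak bound at each level, and Fubini back.
  In the constant, 2 and 5^n come from the distribution bound, p/(p - 1) from the change of weight,
  and 2^(p - 1) from truncating at t/2.\<close>

lemma hl_maximal_strong_bound:
  fixes g :: "real ^ 'n \<Rightarrow> ennreal"
  assumes g: "g \<in> borel_measurable lebesgue" and fin: "\<And>x. g x < \<infinity>" and p: "1 < p"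
  shows "(\<integral>\<^sup>+ x. ennpowr (hl_maximal g x) p \<partial>lebesgue)
    \<le> ennreal (2 * 5 ^ CARD('n) * (p / (p - 1)) * 2 powr (p - 1)) * (\<integral>\<^sup>+ x. ennpowr (g x) p \<partial>lebesgue)"
proof -
  interpret L: sigma_finite_measure "lebesgue :: (real ^ 'n) measure" by (rule sigma_finite_lebesgue)
  interpret P: pair_sigma_finite "lebesgue :: (real ^ 'n) measure" "lborel :: real measure" ..
  let ?w = "\<lambda>t. ennreal (p * t powr (p - 1))"
  let ?v = "\<lambda>t. ennreal ((p - 1) * t powr (p - 1 - 1))"
  let ?c = "2 * 5 ^ CARD('n) * ennreal (p / (p - 1))"
  note g[measurable]
  have "(\<integral>\<^sup>+ x. ennpowr (hl_maximal g x) p \<partial>lebesgue)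
      = (\<integral>\<^sup>+ x. (\<integral>\<^sup>+ t. ?w t * indicator {t. 0 < t \<and> ennreal t < hl_maximal g x} t \<partial>lborel) \<partial>lebesgue)"
    using p by (simp add: ennpowr_eq_nn_integral)
  also have "\<dots> = (\<integral>\<^sup>+ x. (\<integral>\<^sup>+ t. (if 0 < t \<and> ennreal t < hl_maximal g x then ?w t else 0) \<partial>lborel) \<partial>lebesgue)"
    by (intro nn_integral_cong) (auto simp: indicator_def)
  also have "\<dots> = (\<integral>\<^sup>+ t. (\<integral>\<^sup>+ x. (if 0 < t \<and> ennreal t < hl_maximal g x then ?w t else 0) \<partial>lebesgue) \<partial>lborel)"
    by (rule P.Fubini'[symmetric]) measurable
  also have "\<dots> \<le> (\<integral>\<^sup>+ t. ?c * (\<integral>\<^sup>+ x. (if 0 < t \<and> ennreal (t / 2) < g x then g x * ?v t else 0) \<partial>lebesgue) \<partial>lborel)"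
  proof (rule nn_integral_mono)
    fix t :: real
    show "(\<integral>\<^sup>+ x. (if 0 < t \<and> ennreal t < hl_maximal g x then ?w t else 0) \<partial>lebesgue)
      \<le> ?c * (\<integral>\<^sup>+ x. (if 0 < t \<and> ennreal (t / 2) < g x then g x * ?v t else 0) \<partial>lebesgue)"
    proof (cases "0 < t")
      case True
      \<comment> \<open>One factor t is split off for the weak bound; the remaining power t^(p - 2)
        is normalised by p - 1 to be the layer-cake weight of exponent p - 1.\<close>
      have "t powr (p - 1) = t powr (p - 1 - 1) * t"
        using True powr_add[of t "p - 1 - 1" 1] by simp
      then have w: "?w t = ennreal (p / (p - 1)) * ?v t * ennreal t"
        using True p by (simp add: ennreal_mult[symmetric])
      have "(\<integral>\<^sup>+ x. (if 0 < t \<and> ennreal t < hl_maximal g x then ?w t else 0) \<partial>lebesgue)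
          = (\<integral>\<^sup>+ x. ?w t * indicator {x. ennreal t < hl_maximal g x} x \<partial>lebesgue)"
        using True by (intro nn_integral_cong) (auto simp: indicator_def)
      also have "\<dots> = ?w t * emeasure lebesgue {x. ennreal t < hl_maximal g x}"
        using open_hl_maximal[of t g] True by (intro nn_integral_cmult_indicator) auto
      also have "\<dots> = ennreal (p / (p - 1)) * ?v t * (ennreal t * emeasure lebesgue {x. ennreal t < hl_maximal g x})"
        unfolding w by (simp only: mult.assoc)
      also have "\<dots> \<le> ennreal (p / (p - 1)) * ?v t *
          (2 * 5 ^ CARD('n) * (\<integral>\<^sup>+ y. g y * indicator {y. ennreal (t / 2) < g y} y \<partial>lebesgue))"
        by (intro mult_left_mono hl_maximal_distribution_bound[OF g True]) simp
      also have "\<dots> = ?c * (?v t * (\<integral>\<^sup>+ y. g y * indicator {y. ennreal (t / 2) < g y} y \<partial>lebesgue))"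
        by (simp only: mult_ac)
      also have "?v t * (\<integral>\<^sup>+ y. g y * indicator {y. ennreal (t / 2) < g y} y \<partial>lebesgue)
          = (\<integral>\<^sup>+ y. ?v t * (g y * indicator {y. ennreal (t / 2) < g y} y) \<partial>lebesgue)"
        by (rule nn_integral_cmult[symmetric]) (simp add: indicator_def)
      also have "\<dots> = (\<integral>\<^sup>+ x. (if 0 < t \<and> ennreal (t / 2) < g x then g x * ?v t else 0) \<partial>lebesgue)"
        using True by (intro nn_integral_cong) (auto simp: indicator_def mult.commute)
      finally show ?thesis .
    qed simp
  qed
  also have "\<dots> = ?c * (\<integral>\<^sup>+ t. (\<integral>\<^sup>+ x. (if 0 < t \<and> ennreal (t / 2) < g x then g x * ?v t else 0) \<partial>lebesgue) \<partial>lborel)"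
    by (rule nn_integral_cmult) measurable
  also have "(\<integral>\<^sup>+ t. (\<integral>\<^sup>+ x. (if 0 < t \<and> ennreal (t / 2) < g x then g x * ?v t else 0) \<partial>lebesgue) \<partial>lborel)
      = (\<integral>\<^sup>+ x. (\<integral>\<^sup>+ t. (if 0 < t \<and> ennreal (t / 2) < g x then g x * ?v t else 0) \<partial>lborel) \<partial>lebesgue)"
    by (rule P.Fubini') measurable
  also have "\<dots> = (\<integral>\<^sup>+ x. ennreal (2 powr (p - 1)) * ennpowr (g x) p \<partial>lebesgue)"
  proof (rule nn_integral_cong)
    fix x
    obtain c where c: "0 \<le> c" "g x = ennreal c" using fin[of x] by (cases "g x") auto
    \<comment> \<open>The condition t/2 < c means t < 2c, so the layer cake yields (2c)^(p - 1), and
      the factor c completes the p-th power.\<close>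
    have "(\<integral>\<^sup>+ t. (if 0 < t \<and> ennreal (t / 2) < g x then g x * ?v t else 0) \<partial>lborel)
        = (\<integral>\<^sup>+ t. g x * (?v t * indicator {t. 0 < t \<and> ennreal t < ennreal (2 * c)} t) \<partial>lborel)"
      by (intro nn_integral_cong) (auto simp: indicator_def c ennreal_less_iff)
    also have "\<dots> = g x * ennpowr (ennreal (2 * c)) (p - 1)"
      using p ennpowr_eq_nn_integral[of "p - 1" "ennreal (2 * c)"] by (subst nn_integral_cmult) auto
    also have "\<dots> = ennreal (2 powr (p - 1)) * ennpowr (g x) p"
      using c p by (cases "c = 0")
        (simp_all add: ennpowr_def powr_mult powr_diff ennreal_mult[symmetric] field_simps)
    finally show "(\<integral>\<^sup>+ t. (if 0 < t \<and> ennreal (t / 2) < g x then g x * ?v t else 0) \<partial>lborel)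
        = ennreal (2 powr (p - 1)) * ennpowr (g x) p" .
  qed
  also have "\<dots> = ennreal (2 powr (p - 1)) * (\<integral>\<^sup>+ x. ennpowr (g x) p \<partial>lebesgue)"
    by (rule nn_integral_cmult) measurable
  also have "?c * (ennreal (2 powr (p - 1)) * (\<integral>\<^sup>+ x. ennpowr (g x) p \<partial>lebesgue))
      = ennreal (2 * 5 ^ CARD('n) * (p / (p - 1)) * 2 powr (p - 1)) * (\<integral>\<^sup>+ x. ennpowr (g x) p \<partial>lebesgue)"
  proof -
    have "ennreal (2 * 5 ^ CARD('n) * (p / (p - 1)) * 2 powr (p - 1)) = ?c * ennreal (2 powr (p - 1))"
      using p ennreal_power[of 5 "CARD('n)"]
      by (simp add: ennreal_mult del: times_divide_eq_right times_divide_eq_left)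
    then show ?thesis by (simp only: mult.assoc)
  qed
  finally show ?thesis .
qed

section \<open>Pointwise bounds for the set-valued fractional maximal operator\<close>

lemma less_set_norm_iff: "0 \<le> r \<Longrightarrow> ennreal r < set_norm E \<longleftrightarrow> E \<inter> {v. r < norm v} \<noteq> {}"
  by (auto simp: set_norm_def less_SUP_iff ennreal_less_iff)

lemma set_norm_le_iff: "0 \<le> r \<Longrightarrow> set_norm E \<le> ennreal r \<longleftrightarrow> E \<subseteq> cball 0 r"
  by (auto simp: set_norm_def SUP_le_iff ennreal_le_iff)

lemma bounded_iff_set_norm: "bounded E \<longleftrightarrow> set_norm E < \<infinity>"
proof
  assume "bounded E"
  then obtain B where "0 < B" "\<And>v. v \<in> E \<Longrightarrow> norm v \<le> B"
    using bounded_pos by blast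
  then have "E \<subseteq> cball 0 B" "0 \<le> B" by auto
  then have "set_norm E \<le> ennreal B" by (simp add: set_norm_le_iff)
  then show "set_norm E < \<infinity>" by (simp add: le_less_trans)
next
  assume "set_norm E < \<infinity>"
  then obtain B where "0 \<le> B" "set_norm E = ennreal B" by (cases "set_norm E") auto
  then have "E \<subseteq> cball 0 B" by (metis set_norm_le_iff order_refl)
  then show "bounded E" by (rule bounded_subset[OF bounded_cball])
qed

text \<open>The magnitude exceeds r exactly where the set meets the open exterior of a ball, and
  \<open>Kmeasurable\<close> controls such hitting sets.\<close>

lemma borel_measurable_set_norm:
  assumes "Kmeasurable F"
  shows "(\<lambda>x. set_norm (F x)) \<in> borel_measurable lebesgue"
proof (rule borel_measurableI_greater)
  fix y :: ennreal
  show "{x \<in> space lebesgue. y < set_norm (F x)} \<in> sets lebesgue"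
  proof (cases y)
    case (real r)
    have "open {v :: real ^ 'b. r < norm v}" by (intro open_Collect_less continuous_intros)
    then show ?thesis
      using assms real by (simp add: less_set_norm_iff Kmeasurable_def)
  qed simp
qed

text \<open>Zero is the midpoint of v and -v. This is what allows selections to be extended by zero
  to larger cubes.\<close>

lemma zero_in_Kbcs:
  assumes "E \<in> Kbcs"
  shows "0 \<in> E"
proof -
  obtain v where v: "v \<in> E" using assms by (auto simp: Kbcs_def)
  then have "- v \<in> E" using assms by (auto simp: Kbcs_def)
  then have "(1 / 2) *\<^sub>R v + (1 / 2) *\<^sub>R (- v) \<in> E"
    using assms v convexD[of E v "- v" "1 / 2" "1 / 2"] by (auto simp: Kbcs_def)
  then show ?thesis by simp
qed

lemma aumann_integral_norm_le:
  assumes "v \<in> aumann_integral Q F"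
  shows "ennreal (norm v) \<le> (\<integral>\<^sup>+ y\<in>Q. set_norm (F y) \<partial>lebesgue)"
proof -
  obtain f where f: "v = set_lebesgue_integral lebesgue Q f" "set_integrable lebesgue Q f"
    and sel: "AE y in lebesgue. y \<in> Q \<longrightarrow> f y \<in> F y"
    using assms by (auto simp: aumann_integral_def)
  have "ennreal (norm v) \<le> (\<integral>\<^sup>+ y. norm (indicator Q y *\<^sub>R f y) \<partial>lebesgue)"
    using f(2) unfolding f(1) set_integrable_def set_lebesgue_integral_def
    by (rule integral_norm_bound_ennreal)
  also have "\<dots> \<le> (\<integral>\<^sup>+ y\<in>Q. set_norm (F y) \<partial>lebesgue)"
    using sel by (intro nn_integral_mono_AE) (auto simp: indicator_def set_norm_def intro: SUP_upper elim!: eventually_mono)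
  finally show ?thesis .
qed

text \<open>The universal property of the closed convex hull. It is applied to a ball for the size,
  to a reflected copy for the symmetry and to a lower limit for semicontinuity.\<close>

lemma frac_maximal_subset:
  assumes "closed T" "convex T" "\<And>Q w. Q \<in> cubes \<Longrightarrow> w \<in> frac_avg \<alpha> Q F x \<Longrightarrow> w \<in> T"
  shows "frac_maximal \<alpha> F x \<subseteq> T"
  unfolding frac_maximal_def using assms by (intro closure_minimal hull_minimal) auto

lemma frac_avg_subset_frac_maximal: "Q \<in> cubes \<Longrightarrow> frac_avg \<alpha> Q F x \<subseteq> frac_maximal \<alpha> F x"
  unfolding frac_maximal_def by (meson SUP_upper closure_subset hull_subset order_trans)

text \<open>The target is a closed ball. A cube missing x contributes only 0, so only cubes through
  x have to be estimated.\<close>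

lemma set_norm_frac_maximal_le:
  fixes F :: "real ^ 'n \<Rightarrow> (real ^ 'd) set"
  assumes "\<And>a h. 0 < h \<Longrightarrow> x \<in> cube a h \<Longrightarrow>
    ennreal (1 / (h ^ CARD('n)) powr (1 - \<alpha>)) * (\<integral>\<^sup>+ y\<in>cube a h. set_norm (F y) \<partial>lebesgue) \<le> B"
  shows "set_norm (frac_maximal \<alpha> F x) \<le> B"
proof (cases B)
  case (real b)
  have "norm w \<le> b" if w: "w \<in> frac_avg \<alpha> Q F x" and Q: "Q \<in> cubes" for w Q
  proof -
    obtain a h where Q: "Q = cube a h" "0 < h" using Q by (auto simp: cubes_eq)
    obtain v where v: "v \<in> aumann_integral Q F"
      "w = (1 / measure lebesgue Q powr (1 - \<alpha>) * indicator Q x) *\<^sub>R v"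
      using w by (auto simp: frac_avg_def)
    show ?thesis
    proof (cases "x \<in> Q")
      case True
      then have "ennreal (norm w) = ennreal (1 / (h ^ CARD('n)) powr (1 - \<alpha>)) * ennreal (norm v)"
        using Q v(2) by (simp add: measure_cube ennreal_mult[symmetric])
      also have "\<dots> \<le> ennreal (1 / (h ^ CARD('n)) powr (1 - \<alpha>)) * (\<integral>\<^sup>+ y\<in>Q. set_norm (F y) \<partial>lebesgue)"
        using v(1) by (intro mult_left_mono aumann_integral_norm_le) auto
      also have "\<dots> \<le> ennreal b"
        using assms[OF Q(2)] True Q(1) real by simp
      finally show ?thesis using real by simp
    qed (use v real in simp)
  qed
  then have "frac_maximal \<alpha> F x \<subseteq> cball 0 b" by (intro frac_maximal_subset) auto
  then show ?thesis using real by (simp add: set_norm_le_iff)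
qed simp

section \<open>Powers of extended reals, Hoelder and Hedberg bounds\<close>

lemma ennpowr_mono: "a \<le> b \<Longrightarrow> 0 \<le> r \<Longrightarrow> ennpowr a r \<le> ennpowr b r"
  by (cases a; cases b) (auto simp: ennpowr_def powr_mono2 top_unique)

lemma ennpowr_ennpowr: "ennpowr (ennpowr a r) s = ennpowr a (r * s)"
  by (cases a) (auto simp: ennpowr_def powr_powr)

lemma ennpowr_mult_real:
  assumes "0 \<le> c" "0 < r"
  shows "ennpowr (a * ennreal c) r = ennpowr a r * ennreal (c powr r)"
proof (cases a)
  case (real b)
  then show ?thesis using assms
    by (simp add: ennpowr_def ennreal_mult[symmetric] powr_mult enn2real_mult)
next
  case top
  then show ?thesis using assms
    by (cases "c = 0") (auto simp: ennpowr_def ennreal_top_mult)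
qed

lemma ennpowr_eq_top_iff [simp]: "ennpowr a r = top \<longleftrightarrow> a = top"
  by (auto simp: ennpowr_def)

text \<open>Either a \<le> s, or a = a^(1 - p) a^p with a^(1 - p) \<le> s^(1 - p), since the
  exponent 1 - p is not positive. The free threshold s is optimised after integration.\<close>

lemma ennreal_Young:
  assumes "a < \<infinity>" "0 < s" "1 \<le> p"
  shows "a \<le> ennreal s + ennreal (s powr (1 - p)) * ennpowr a p"
proof -
  obtain c where c: "0 \<le> c" "a = ennreal c" using assms(1) by (cases a) auto
  have "c \<le> s + s powr (1 - p) * c powr p"
  proof (cases "c \<le> s")
    case False
    then have "c = c powr (1 - p) * c powr p"
      using assms(2) by (simp add: powr_add[symmetric])
    also have "\<dots> \<le> s powr (1 - p) * c powr p"
      using assms False by (intro mult_right_mono powr_mono2') auto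
    finally show ?thesis using assms(2) by simp
  qed (use assms in \<open>simp add: add_increasing2\<close>)
  then show ?thesis
    using c assms(2) by (simp add: ennpowr_def ennreal_mult[symmetric] ennreal_plus[symmetric] del: ennreal_plus)
qed

text \<open>Hoelder's inequality against the indicator of \<open>Q\<close>, up to a factor 2: the
  pointwise Young bound is integrated and s chosen to balance its two terms.\<close>

lemma nn_integral_Holder_rough:
  assumes f: "f \<in> borel_measurable M" "\<And>y. f y < \<infinity>" and Q: "Q \<in> sets M" "emeasure M Q = ennreal m" "0 < m"
    and p: "1 \<le> p" and N: "0 \<le> N" "(\<integral>\<^sup>+ y. ennpowr (f y) p \<partial>M) = ennreal (N powr p)"
  shows "(\<integral>\<^sup>+ y\<in>Q. f y \<partial>M) \<le> ennreal (2 * m powr (1 - 1 / p) * N)"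
proof -
  note f(1)[measurable]
  have Young: "(\<integral>\<^sup>+ y\<in>Q. f y \<partial>M) \<le> ennreal (s * m + s powr (1 - p) * N powr p)" if s: "0 < s" for s
  proof -
    have "(\<integral>\<^sup>+ y\<in>Q. f y \<partial>M)
        \<le> (\<integral>\<^sup>+ y. ennreal s * indicator Q y + ennreal (s powr (1 - p)) * ennpowr (f y) p \<partial>M)"
      using ennreal_Young[OF f(2) s p] by (intro nn_integral_mono) (auto simp: indicator_def)
    also have "\<dots> = ennreal s * emeasure M Q + ennreal (s powr (1 - p)) * (\<integral>\<^sup>+ y. ennpowr (f y) p \<partial>M)"
      using Q(1) by (subst nn_integral_add) (auto simp: nn_integral_cmult nn_integral_cmult_indicator)
    also have "\<dots> = ennreal (s * m + s powr (1 - p) * N powr p)"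
      using Q N s by (simp add: ennreal_mult)
    finally show ?thesis .
  qed
  show ?thesis
  proof (cases "N = 0")
    case True
    \<comment> \<open>The balancing s would be 0 here, which Young's bound excludes; s = e/m with e
      arbitrarily small replaces it.\<close>
    have "(\<integral>\<^sup>+ y\<in>Q. f y \<partial>M) \<le> 0 + ennreal e" if "0 < e" for e
      using Young[of "e / m"] that Q(3) True by simp
    then have "(\<integral>\<^sup>+ y\<in>Q. f y \<partial>M) \<le> 0" by (rule ennreal_le_epsilon)
    then show ?thesis by simp
  next
    case False
    then have pos: "0 < N" using N(1) by simp
    \<comment> \<open>This s makes both terms equal to N m^(1 - 1/p); their sum is the source of the
      2.\<close>
    define s where "s = N * m powr (- (1 / p))"
    have "s * m = m powr (1 - 1 / p) * N"
      using Q(3) powr_add[of m 1 "- (1 / p)"] by (simp add: s_def mult_ac)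
    moreover have "s powr (1 - p) * N powr p = m powr (1 - 1 / p) * N"
    proof -
      have e1: "s powr (1 - p) = N powr (1 - p) * m powr (- (1 / p) * (1 - p))"
        using pos by (simp only: s_def powr_mult powr_powr)
      have e2: "- (1 / p) * (1 - p) = 1 - 1 / p" using p by (simp add: field_simps)
      have e3: "N powr (1 - p) * N powr p = N" using pos by (simp add: powr_add[symmetric])
      have "s powr (1 - p) * N powr p = m powr (1 - 1 / p) * (N powr (1 - p) * N powr p)"
        unfolding e1 e2 by (simp only: mult_ac)
      then show ?thesis unfolding e3 .
    qed
    moreover have "0 < s" using pos Q(3) by (simp add: s_def)
    ultimately show ?thesis
      using Young[of s] by (simp add: mult_ac)
  qed
qed

text \<open>The weights 1 - \<alpha> p and \<alpha> p are forced by the powers of m: (1 - \<alpha>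
  p) + (1 - 1/p) \<alpha> p = 1 - \<alpha>, exactly the normalising exponent.\<close>

lemma Hedberg_real:
  fixes A m N M :: real
  assumes "0 \<le> A" "0 < m" "0 \<le> N" "0 \<le> M" "0 < p" "0 < \<alpha>"
    and "A \<le> m * M" "A \<le> 2 * m powr (1 - 1 / p) * N" "\<alpha> * p < 1"
  shows "1 / m powr (1 - \<alpha>) * A \<le> M powr (1 - \<alpha> * p) * (2 * N) powr (\<alpha> * p)"
proof -
  have "A = A powr (1 - \<alpha> * p) * A powr (\<alpha> * p)"
    using assms(1) by (cases "A = 0") (simp_all add: powr_add[symmetric])
  also have "\<dots> \<le> (m * M) powr (1 - \<alpha> * p) * (2 * m powr (1 - 1 / p) * N) powr (\<alpha> * p)"
    using assms by (intro mult_mono powr_mono2) auto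
  also have "\<dots> = (m powr (1 - \<alpha> * p) * m powr ((1 - 1 / p) * (\<alpha> * p))) *
      (M powr (1 - \<alpha> * p) * (2 * N) powr (\<alpha> * p))"
    using assms by (simp add: powr_mult powr_powr mult_ac)
  also have "m powr (1 - \<alpha> * p) * m powr ((1 - 1 / p) * (\<alpha> * p)) = m powr (1 - \<alpha>)"
  proof -
    have "1 - \<alpha> * p + (1 - 1 / p) * (\<alpha> * p) = 1 - \<alpha>" using assms by (simp add: field_simps)
    then show ?thesis by (metis powr_add)
  qed
  finally show ?thesis using assms by (simp add: field_simps)
qed

lemma cube_integral_set_norm_le:
  fixes F :: "real ^ 'n \<Rightarrow> (real ^ 'd) set"
  assumes F: "Kmeasurable F" "\<And>y. F y \<in> Kbcs" and p: "1 \<le> p"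
    and N: "0 \<le> N" "(\<integral>\<^sup>+ y. ennpowr (set_norm (F y)) p \<partial>lebesgue) = ennreal (N powr p)"
    and h: "0 < h"
  shows "(\<integral>\<^sup>+ y\<in>cube a h. set_norm (F y) \<partial>lebesgue) \<le> ennreal (2 * (h ^ CARD('n)) powr (1 - 1 / p) * N)"
proof (rule nn_integral_Holder_rough)
  show "set_norm (F y) < \<infinity>" for y
    using F(2)[of y] bounded_iff_set_norm by (auto simp: Kbcs_def)
qed (use assms in \<open>simp_all add: borel_measurable_set_norm emeasure_cube del: emeasure_completion\<close>)

text \<open>Hedberg's inequality: the average over \<open>Q\<close> is at most the Hardy--Littlewood function,
  and at most a power of \<open>|Q|\<close> times the \<open>L\<^sup>p\<close> norm; a geometric mean of both cancels \<open>|Q|\<close>.\<close>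

lemma frac_maximal_Hedberg:
  fixes F :: "real ^ 'n \<Rightarrow> (real ^ 'd) set"
  assumes F: "Kmeasurable F" "\<And>y. F y \<in> Kbcs" and p: "1 \<le> p" and \<alpha>: "0 < \<alpha>" "\<alpha> * p < 1"
    and N: "0 \<le> N" "(\<integral>\<^sup>+ y. ennpowr (set_norm (F y)) p \<partial>lebesgue) = ennreal (N powr p)"
  shows "set_norm (frac_maximal \<alpha> F x)
    \<le> ennpowr (hl_maximal (\<lambda>y. set_norm (F y)) x) (1 - \<alpha> * p) * ennreal ((2 * N) powr (\<alpha> * p))"
proof (rule set_norm_frac_maximal_le)
  fix a and h :: real
  assume h: "0 < h" "x \<in> cube a h"
  let ?H = "hl_maximal (\<lambda>y. set_norm (F y)) x" and ?m = "h ^ CARD('n)"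
  let ?A = "\<integral>\<^sup>+ y\<in>cube a h. set_norm (F y) \<partial>lebesgue"
  have Holder: "?A \<le> ennreal (2 * ?m powr (1 - 1 / p) * N)"
    using cube_integral_set_norm_le[OF F p N h(1)] .
  then obtain A where A: "0 \<le> A" "?A = ennreal A"
    by (cases ?A) (auto simp: top_unique)
  have A2: "A \<le> 2 * ?m powr (1 - 1 / p) * N"
    using Holder A N h by (simp add: ennreal_le_iff)
  show "ennreal (1 / ?m powr (1 - \<alpha>)) * ?A \<le> ennpowr ?H (1 - \<alpha> * p) * ennreal ((2 * N) powr (\<alpha> * p))"
  proof (cases ?H)
    case (real M)
    have "A \<le> ?m * M"
      using cube_integral_le_hl_maximal[OF h, of "\<lambda>y. set_norm (F y)"] A real h
      by (simp add: ennreal_mult[symmetric])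
    then have "1 / ?m powr (1 - \<alpha>) * A \<le> M powr (1 - \<alpha> * p) * (2 * N) powr (\<alpha> * p)"
      using A A2 N p \<alpha> h real by (intro Hedberg_real) auto
    then have "ennreal (1 / ?m powr (1 - \<alpha>) * A) \<le> ennreal (M powr (1 - \<alpha> * p) * (2 * N) powr (\<alpha> * p))"
      by (rule ennreal_leI)
    then show ?thesis
      using A real by (simp add: ennpowr_def ennreal_mult[symmetric])
  next
    case top
    show ?thesis
    \<comment> \<open>For N = 0 the right-hand side is infinity times 0, which is 0, so the Hoelder
      bound has to supply A = 0.\<close>
    proof (cases "N = 0")
      case True
      then show ?thesis using A A2 by simp
    next
      case False
      then show ?thesis using top N by (simp add: ennpowr_def ennreal_top_mult)
    qed
  qed
qed

text \<open>At \<alpha> p = 1 the Hoelder bound carries precisely the power of |Q| in the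
  normalisation, so it cancels without the maximal function, and the bound holds at every
  point.\<close>

lemma frac_maximal_endpoint:
  fixes F :: "real ^ 'n \<Rightarrow> (real ^ 'd) set"
  assumes F: "Kmeasurable F" "\<And>y. F y \<in> Kbcs" and p: "1 \<le> p"
    and N: "0 \<le> N" "(\<integral>\<^sup>+ y. ennpowr (set_norm (F y)) p \<partial>lebesgue) = ennreal (N powr p)"
  shows "set_norm (frac_maximal (1 / p) F x) \<le> ennreal (2 * N)"
proof (rule set_norm_frac_maximal_le)
  fix a and h :: real
  assume h: "0 < h" "x \<in> cube a h"
  let ?m = "h ^ CARD('n)"
  let ?A = "\<integral>\<^sup>+ y\<in>cube a h. set_norm (F y) \<partial>lebesgue"
  have "?A \<le> ennreal (2 * ?m powr (1 - 1 / p) * N)"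
    using cube_integral_set_norm_le[OF F p N h(1)] .
  then have "ennreal (1 / ?m powr (1 - 1 / p)) * ?A
      \<le> ennreal (1 / ?m powr (1 - 1 / p)) * ennreal (2 * ?m powr (1 - 1 / p) * N)"
    by (rule mult_left_mono) simp
  also have "\<dots> = ennreal (2 * N)"
    using h N by (simp add: ennreal_mult[symmetric])
  finally show "ennreal (1 / ?m powr (1 - 1 / p)) * ?A \<le> ennreal (2 * N)" .
qed

section \<open>Lower semicontinuity and measurability\<close>

lemma zero_in_aumann_integral:
  assumes "\<And>y. 0 \<in> F y"
  shows "0 \<in> aumann_integral Q F"
  unfolding aumann_integral_def using assms
  by (intro CollectI exI[of _ "\<lambda>_. 0"]) (auto simp: set_integrable_def set_lebesgue_integral_def)

text \<open>A selection on the smaller set is extended by zero, which is again a selection and has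
  the same integral.\<close>

lemma aumann_integral_mono:
  assumes "\<And>y. 0 \<in> F y" "Q \<subseteq> Q'"
  shows "aumann_integral Q F \<subseteq> aumann_integral Q' F"
proof
  fix v assume "v \<in> aumann_integral Q F"
  then obtain f where f: "v = set_lebesgue_integral lebesgue Q f" "set_integrable lebesgue Q f"
    and sel: "AE y in lebesgue. y \<in> Q \<longrightarrow> f y \<in> F y"
    by (auto simp: aumann_integral_def)
  have eq: "indicat_real Q' y *\<^sub>R indicat_real Q y *\<^sub>R f y = indicat_real Q y *\<^sub>R f y" for y
    using assms(2) by (auto simp: indicator_def)
  have "AE y in lebesgue. y \<in> Q' \<longrightarrow> indicat_real Q y *\<^sub>R f y \<in> F y"
    using sel assms(1) by (auto simp: indicator_def elim!: eventually_mono)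
  then show "v \<in> aumann_integral Q' F"
    using f unfolding aumann_integral_def set_integrable_def set_lebesgue_integral_def
    by (intro CollectI exI[of _ "\<lambda>y. indicat_real Q y *\<^sub>R f y"]) (simp only: eq simp_thms)
qed

lemma aumann_integral_uminus:
  assumes "\<And>y. uminus ` F y = F y" "v \<in> aumann_integral Q F"
  shows "- v \<in> aumann_integral Q F"
proof -
  obtain f where f: "v = set_lebesgue_integral lebesgue Q f" "set_integrable lebesgue Q f"
    and sel: "AE y in lebesgue. y \<in> Q \<longrightarrow> f y \<in> F y"
    using assms(2) by (auto simp: aumann_integral_def)
  have "AE y in lebesgue. y \<in> Q \<longrightarrow> - f y \<in> F y"
    using sel assms(1) by (auto elim!: eventually_mono)
  then show ?thesis
    using f unfolding aumann_integral_def
    by (intro CollectI exI[of _ "\<lambda>y. - f y"]) (simp add: set_integrable_def set_lebesgue_integral_def)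
qed

lemma zero_in_frac_maximal:
  assumes "\<And>y. 0 \<in> F y"
  shows "0 \<in> frac_maximal \<alpha> F x"
proof -
  have "0 \<in> frac_avg \<alpha> (cube 0 1) F x"
    unfolding frac_avg_def by (rule image_eqI[OF _ zero_in_aumann_integral]) (use assms in auto)
  then show ?thesis
    using frac_avg_subset_frac_maximal[of "cube 0 1" \<alpha> F x] by auto
qed

lemma closed_frac_maximal: "closed (frac_maximal \<alpha> F x)"
  and convex_frac_maximal: "convex (frac_maximal \<alpha> F x)"
  by (simp_all add: frac_maximal_def convex_closure convex_convex_hull)

text \<open>The preimage of a closed convex set under negation is closed and convex, so it is enough
  to reflect single averages.\<close>

lemma frac_maximal_uminus:
  assumes "\<And>y. uminus ` F y = F y"
  shows "uminus ` frac_maximal \<alpha> F x = frac_maximal \<alpha> F x"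
proof -
  have "frac_maximal \<alpha> F x \<subseteq> uminus -` frac_maximal \<alpha> F x"
  proof (rule frac_maximal_subset)
    show "closed (uminus -` frac_maximal \<alpha> F x)"
      by (intro closed_vimage closed_frac_maximal continuous_intros)
    show "convex (uminus -` frac_maximal \<alpha> F x)"
      by (intro convex_linear_vimage convex_frac_maximal linear_uminus)
  next
    fix Q w assume Q: "Q \<in> cubes" and "w \<in> frac_avg \<alpha> Q F x"
    then obtain u where "u \<in> aumann_integral Q F" "w = (1 / measure lebesgue Q powr (1 - \<alpha>) * indicator Q x) *\<^sub>R u"
      unfolding frac_avg_def by blast
    then have "- w \<in> frac_avg \<alpha> Q F x"
      unfolding frac_avg_def by (intro image_eqI[of _ _ "- u"] aumann_integral_uminus[of F, OF assms]) simp_all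
    then show "w \<in> uminus -` frac_maximal \<alpha> F x"
      using frac_avg_subset_frac_maximal[OF Q] by blast
  qed
  then have "- v \<in> frac_maximal \<alpha> F x" if "v \<in> frac_maximal \<alpha> F x" for v using that by blast
  then show ?thesis by (metis (no_types, opaque_lifting) image_subsetI minus_minus image_eqI subsetI subset_antisym)
qed

section \<open>Lower limits of set-valued maps\<close>

definition lower_limit :: "('a::topological_space \<Rightarrow> 'b::metric_space set) \<Rightarrow> 'a \<Rightarrow> 'b set" where
  "lower_limit C x = {v. \<forall>e>0. \<forall>\<^sub>F y in nhds x. \<exists>w\<in>C y. dist w v < e}"

lemma closed_lower_limit: "closed (lower_limit C x)"
proof -
  have "v \<in> lower_limit C x" if v: "v \<in> closure (lower_limit C x)" for v
    unfolding lower_limit_def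
  proof (intro CollectI allI impI)
    fix e :: real assume "0 < e"
    then obtain u where u: "u \<in> lower_limit C x" "dist u v < e / 2"
      using v unfolding closure_approachable by (meson half_gt_zero)
    then have "\<forall>\<^sub>F y in nhds x. \<exists>w\<in>C y. dist w u < e / 2"
      using half_gt_zero[OF \<open>0 < e\<close>] unfolding lower_limit_def by blast
    then show "\<forall>\<^sub>F y in nhds x. \<exists>w\<in>C y. dist w v < e"
      using u(2) by (elim eventually_mono) (meson dist_triangle_half_r dist_commute_lessI dist_triangle_half_l)
  qed
  then show ?thesis by (metis closure_subset closure_closed closed_closure subset_antisym subsetI)
qed

lemma convex_lower_limit:
  fixes C :: "'a::topological_space \<Rightarrow> 'b::real_normed_vector set"
  assumes "\<And>y. convex (C y)"
  shows "convex (lower_limit C x)"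
proof (rule convexI)
  fix v1 v2 :: 'b and s t :: real
  assume v: "v1 \<in> lower_limit C x" "v2 \<in> lower_limit C x" and st: "0 \<le> s" "0 \<le> t" "s + t = 1"
  show "s *\<^sub>R v1 + t *\<^sub>R v2 \<in> lower_limit C x"
    unfolding lower_limit_def
  proof (intro CollectI allI impI)
    fix e :: real assume e: "0 < e"
    have ev: "\<forall>\<^sub>F y in nhds x. \<exists>w\<in>C y. dist w v1 < e" "\<forall>\<^sub>F y in nhds x. \<exists>w\<in>C y. dist w v2 < e"
      using v e by (auto simp: lower_limit_def)
    show "\<forall>\<^sub>F y in nhds x. \<exists>w\<in>C y. dist w (s *\<^sub>R v1 + t *\<^sub>R v2) < e"
      using eventually_conj[OF ev]
    proof eventually_elim
      case (elim y)
      then obtain w1 w2 where w: "w1 \<in> C y" "w2 \<in> C y" "norm (w1 - v1) < e" "norm (w2 - v2) < e"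
        by (auto simp: dist_norm)
      have "norm (s *\<^sub>R (w1 - v1) + t *\<^sub>R (w2 - v2)) \<le> s * norm (w1 - v1) + t * norm (w2 - v2)"
        using st by (metis abs_of_nonneg norm_scaleR norm_triangle_ineq)
      also have "\<dots> < e" using w st by (intro convex_bound_lt) auto
      also have "s *\<^sub>R (w1 - v1) + t *\<^sub>R (w2 - v2) = (s *\<^sub>R w1 + t *\<^sub>R w2) - (s *\<^sub>R v1 + t *\<^sub>R v2)"
        by (simp add: algebra_simps)
      finally show ?case
        using convexD[OF assms w(1,2) st] by (auto simp: dist_norm)
    qed
  qed
qed

text \<open>Lower semicontinuity: a cube through \<open>x\<close> is enlarged so that it contains a neighbourhood
  of \<open>x\<close>, and a selection is extended by \<open>0\<close>, which changes the average only by a factor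
  close to \<open>1\<close>.\<close>

lemma frac_maximal_subset_lower_limit:
  fixes F :: "real ^ 'n \<Rightarrow> (real ^ 'd) set"
  assumes zero: "\<And>y. 0 \<in> F y"
  shows "frac_maximal \<alpha> F x \<subseteq> lower_limit (frac_maximal \<alpha> F) x"
proof (intro frac_maximal_subset closed_lower_limit convex_lower_limit convex_frac_maximal)
  fix Q and w :: "real ^ 'd"
  assume Q: "Q \<in> cubes" and w: "w \<in> frac_avg \<alpha> Q F x"
  obtain u where u: "u \<in> aumann_integral Q F" "w = (1 / measure lebesgue Q powr (1 - \<alpha>) * indicator Q x) *\<^sub>R u"
    using w by (auto simp: frac_avg_def)
  show "w \<in> lower_limit (frac_maximal \<alpha> F) x"
  proof (cases "x \<in> Q")
    \<comment> \<open>A cube missing x contributes only 0, which lies in every value of the maximal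
      operator.\<close>
    case False
    then show ?thesis
      using u zero_in_frac_maximal[of F, OF zero]
      by (auto simp: lower_limit_def intro!: always_eventually bexI[of _ 0])
  next
    case True
    obtain a h where Q: "Q = cube a h" "0 < h" using Q by (auto simp: cubes_eq)
    define \<phi> where "\<phi> h = 1 / (h ^ CARD('n)) powr (1 - \<alpha>)" for h :: real
    have w: "w = \<phi> h *\<^sub>R u" using u True Q by (simp add: measure_cube \<phi>_def)
    show ?thesis
      unfolding lower_limit_def
    proof (intro CollectI allI impI)
      fix e :: real assume e: "0 < e"
      have "((\<lambda>d. \<phi> (h + 2 * d) *\<^sub>R u) \<longlongrightarrow> \<phi> (h + 2 * 0) *\<^sub>R u) (at_right 0)"
        unfolding \<phi>_def using Q(2) by (intro tendsto_intros) auto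
      then have "\<forall>\<^sub>F d in at_right 0. dist (\<phi> (h + 2 * d) *\<^sub>R u) w < e"
        using e by (simp add: w tendsto_iff)
      then have "\<forall>\<^sub>F d in at_right 0. 0 < d \<and> dist (\<phi> (h + 2 * d) *\<^sub>R u) w < e"
        using eventually_at_right_less[of "0::real"] by (rule eventually_conj[rotated])
      then obtain d where d: "0 < d" "dist (\<phi> (h + 2 * d) *\<^sub>R u) w < e"
        using eventually_happens'[OF trivial_limit_at_right_real] by blast
      have cube: "expand_cube d a h \<in> cubes" using d(1) Q(2) by (simp add: expand_cube_def)
      have u': "u \<in> aumann_integral (expand_cube d a h) F"
        using u(1) aumann_integral_mono[of F, OF zero cube_subset_expand_cube[of d a h]] d(1) Q(1) by auto
      have "\<phi> (h + 2 * d) *\<^sub>R u \<in> frac_maximal \<alpha> F y" if "y \<in> expand_cube d a h" for y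
      proof -
        have "\<phi> (h + 2 * d) *\<^sub>R u \<in> frac_avg \<alpha> (expand_cube d a h) F y"
          unfolding frac_avg_def using u' that d(1) Q(2)
          by (intro image_eqI[OF _ u']) (simp add: \<phi>_def expand_cube_def measure_cube)
        then show ?thesis using frac_avg_subset_frac_maximal[OF cube] by blast
      qed
      then show "\<forall>\<^sub>F y in nhds x. \<exists>w'\<in>frac_maximal \<alpha> F y. dist w' w < e"
        using eventually_mem_expand_cube[of x a h d] True Q(1) d by (auto elim!: eventually_mono)
    qed
  qed
qed

lemma open_frac_maximal_hits:
  fixes F :: "real ^ 'n \<Rightarrow> (real ^ 'd) set"
  assumes zero: "\<And>y. 0 \<in> F y" and U: "open U"
  shows "open {x. frac_maximal \<alpha> F x \<inter> U \<noteq> {}}"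
proof -
  have "\<forall>\<^sub>F y in nhds x. frac_maximal \<alpha> F y \<inter> U \<noteq> {}" if ne: "frac_maximal \<alpha> F x \<inter> U \<noteq> {}" for x
  proof -
    obtain v where v: "v \<in> frac_maximal \<alpha> F x" "v \<in> U" using ne by blast
    obtain e where e: "0 < e" "\<And>w. dist w v < e \<Longrightarrow> w \<in> U"
      using U v(2) unfolding open_dist by blast
    have "\<forall>\<^sub>F y in nhds x. \<exists>w\<in>frac_maximal \<alpha> F y. dist w v < e"
      using frac_maximal_subset_lower_limit[of F \<alpha> x] zero v(1) e(1) by (auto simp: lower_limit_def)
    then show ?thesis using e(2) by (elim eventually_mono) blast
  qed
  then show ?thesis
    unfolding open_dist eventually_nhds_metric by simp
qed

lemma Kmeasurable_frac_maximal:
  assumes "\<And>y. 0 \<in> F y"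
  shows "Kmeasurable (frac_maximal \<alpha> F)"
  unfolding Kmeasurable_def using open_frac_maximal_hits[of F, OF assms] by simp

text \<open>The representative \<open>G\<close> resets unbounded values to {0}. It stays measurable
  because boundedness is a level condition on the magnitude, and its magnitude is dominated at every
  point, so norm bounds pass to it by monotonicity.\<close>

lemma frac_maximal_ae_Kbcs:
  fixes F :: "real ^ 'n \<Rightarrow> (real ^ 'd) set"
  assumes F: "\<And>y. F y \<in> Kbcs" and fin: "AE x in lebesgue. set_norm (frac_maximal \<alpha> F x) < \<infinity>"
  shows "\<exists>G. (\<forall>x. G x \<in> Kbcs) \<and> Kmeasurable G \<and> (AE x in lebesgue. frac_maximal \<alpha> F x = G x) \<and>
    (\<forall>x. set_norm (G x) \<le> set_norm (frac_maximal \<alpha> F x))"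
proof -
  let ?M = "frac_maximal \<alpha> F"
  define G where "G x = (if bounded (?M x) then ?M x else {0})" for x
  have zero: "0 \<in> F y" for y using F zero_in_Kbcs by blast
  have zeroM: "0 \<in> ?M x" for x using zero by (rule zero_in_frac_maximal)
  show ?thesis
  proof (intro exI[of _ G] conjI allI)
    show "G x \<in> Kbcs" for x
      using frac_maximal_uminus[of F] F zeroM[of x] closed_frac_maximal convex_frac_maximal
      by (auto simp: G_def Kbcs_def)
    show "Kmeasurable G"
      unfolding Kmeasurable_def
    proof (intro allI impI)
      fix U :: "(real ^ 'd) set" assume "open U"
      have "{x. bounded (?M x)} = {x \<in> space lebesgue. set_norm (?M x) < \<infinity>}"
        by (simp add: bounded_iff_set_norm)
      also have "\<dots> \<in> sets lebesgue"
        using borel_measurable_set_norm[OF Kmeasurable_frac_maximal[of F, OF zero]]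
        by (intro borel_measurable_less) auto
      finally have B: "{x. bounded (?M x)} \<in> sets lebesgue" .
      have H: "{x. ?M x \<inter> U \<noteq> {}} \<in> sets lebesgue"
        using open_frac_maximal_hits[of F, OF zero \<open>open U\<close>] by simp
      have "{x. G x \<inter> U \<noteq> {}} = ({x. bounded (?M x)} \<inter> {x. ?M x \<inter> U \<noteq> {}}) \<union>
          (if 0 \<in> U then - {x. bounded (?M x)} else {})"
        by (auto simp: G_def)
      also have "\<dots> \<in> sets lebesgue"
        using B H sets.compl_sets[OF B] by (auto simp: Compl_eq_Diff_UNIV)
      finally show "{x. G x \<inter> U \<noteq> {}} \<in> sets lebesgue" .
    qed
    show "AE x in lebesgue. ?M x = G x"
      using fin by eventually_elim (simp add: G_def bounded_iff_set_norm)
    show "set_norm (G x) \<le> set_norm (?M x)" for x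
      using zeroM[of x] by (auto simp: G_def set_norm_def)
  qed
qed

section \<open>Norm inequalities\<close>

text \<open>Writing the finite integral as N^p, with N the norm, is the form in which the Hoelder
  and Hedberg bounds are homogeneous in N.\<close>

lemma LpK_normE:
  fixes F :: "real ^ 'n \<Rightarrow> (real ^ 'd) set"
  assumes "F \<in> LpK (ereal p)" "1 \<le> p"
  obtains N where "0 \<le> N" "(\<integral>\<^sup>+ y. ennpowr (set_norm (F y)) p \<partial>lebesgue) = ennreal (N powr p)"
    "LpK_norm (ereal p) F = ennreal N"
proof -
  let ?I = "\<integral>\<^sup>+ y. ennpowr (set_norm (F y)) p \<partial>lebesgue"
  have norm: "LpK_norm (ereal p) F = ennpowr ?I (1 / p)" by (simp add: LpK_norm_def)
  have "ennpowr ?I (1 / p) < \<infinity>" using assms(1) by (simp add: LpK_def norm)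
  then have "?I \<noteq> top" using ennpowr_eq_top_iff[of ?I "1 / p"] by (auto simp del: ennpowr_eq_top_iff)
  then obtain i where i: "0 \<le> i" "?I = ennreal i" by (cases ?I) auto
  show thesis
  proof (rule that[of "i powr (1 / p)"])
    show "?I = ennreal ((i powr (1 / p)) powr p)"
      using i assms(2) by (simp add: powr_powr)
    show "LpK_norm (ereal p) F = ennreal (i powr (1 / p))"
      using i by (simp add: norm ennpowr_def)
  qed simp
qed

lemma LpK_norm_mono:
  assumes "Kmeasurable G" "\<And>x. set_norm (G x) \<le> set_norm (H x)" "p = \<infinity> \<or> 0 < p"
  shows "LpK_norm p G \<le> LpK_norm p H"
proof (cases "p = \<infinity>")
  case True
  then show ?thesis
    using assms by (simp add: LpK_norm_def esssup_mono borel_measurable_set_norm)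
next
  case False
  then have "0 < real_of_ereal p" using assms(3) by (cases p) auto
  then show ?thesis
    using assms(2) False by (auto simp: LpK_norm_def intro!: ennpowr_mono nn_integral_mono)
qed

text \<open>Measurability is asked of the larger function: \<open>emeasure\<close> is 0 on
  non-measurable sets, so monotonicity needs a measurable superset.\<close>

lemma weak_LpK_norm_mono:
  assumes "Kmeasurable H" "\<And>x. set_norm (G x) \<le> set_norm (H x)" "0 < p"
  shows "weak_LpK_norm p G \<le> weak_LpK_norm p H"
proof -
  have "{x. ennreal l < set_norm (H x)} \<in> sets lebesgue" for l
    using borel_measurable_less[OF borel_measurable_const[of "ennreal l"] borel_measurable_set_norm[OF assms(1)]]
    by simp
  then show ?thesis
    unfolding weak_LpK_norm_def using assms(2,3)
    by (intro SUP_mono' mult_left_mono ennpowr_mono emeasure_mono) (auto intro: less_le_trans)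
qed

lemma frac_maximal_L_infinity:
  fixes F :: "real ^ 'n \<Rightarrow> (real ^ 'd) set"
  assumes p: "1 \<le> p" and F: "F \<in> LpK (ereal p)"
  shows "ae_member (frac_maximal (1 / p) F) (LpK \<infinity>)"
    and "LpK_norm \<infinity> (frac_maximal (1 / p) F) \<le> ennreal 2 * LpK_norm (ereal p) F"
proof -
  obtain N where N: "0 \<le> N" "(\<integral>\<^sup>+ y. ennpowr (set_norm (F y)) p \<partial>lebesgue) = ennreal (N powr p)"
    "LpK_norm (ereal p) F = ennreal N"
    using LpK_normE[OF F p] by blast
  have K: "Kmeasurable F" "\<And>y. F y \<in> Kbcs" using F by (auto simp: LpK_def)
  let ?M = "frac_maximal (1 / p) F"
  have M: "set_norm (?M x) \<le> ennreal (2 * N)" for x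
    by (rule frac_maximal_endpoint[OF K p N(1,2)])
  have "Kmeasurable ?M"
    by (intro Kmeasurable_frac_maximal zero_in_Kbcs K)
  then have le: "LpK_norm \<infinity> ?M \<le> ennreal (2 * N)"
    using M by (simp add: LpK_norm_def esssup_I borel_measurable_set_norm)
  then show "LpK_norm \<infinity> ?M \<le> ennreal 2 * LpK_norm (ereal p) F"
    using N(1) by (simp add: N(3) ennreal_mult)
  have "AE x in lebesgue. set_norm (?M x) < \<infinity>"
    using le_less_trans[OF M] by simp
  then obtain G where G: "\<forall>x. G x \<in> Kbcs" "Kmeasurable G" "AE x in lebesgue. ?M x = G x"
    "\<forall>x. set_norm (G x) \<le> set_norm (?M x)"
    using frac_maximal_ae_Kbcs[of F, OF K(2)] by blast
  have "LpK_norm \<infinity> G \<le> LpK_norm \<infinity> ?M"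
    by (rule LpK_norm_mono[OF G(2) G(4)[rule_format]]) simp
  then have "LpK_norm \<infinity> G < \<infinity>"
    using le_less_trans[OF order_trans[OF _ le] ennreal_less_top] by simp
  then have "G \<in> LpK \<infinity>"
    using G(1,2) by (simp add: LpK_def)
  then show "ae_member ?M (LpK \<infinity>)"
    using G(3) unfolding ae_member_def by blast
qed

text \<open>Since 1 - \<alpha> p = p/q, the q-th power of Hedberg's bound involves H^p, to which the
  strong (p,p) bound applies. After the q-th root the powers of N add up to \<alpha> p + p/q = 1,
  and \<open>C\<close> combines 2^(\<alpha> p) with the q-th root of the strong constant.\<close>

lemma frac_maximal_strong:
  fixes F :: "real ^ 'n \<Rightarrow> (real ^ 'd) set"
  assumes p: "1 < p" "p < q" and \<alpha>: "0 < \<alpha>" "1 / p - 1 / q = \<alpha>" and F: "F \<in> LpK (ereal p)"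
  defines "C \<equiv> 2 powr (\<alpha> * p) * (2 * 5 ^ CARD('n) * (p / (p - 1)) * 2 powr (p - 1)) powr (1 / q)"
  shows "ae_member (frac_maximal \<alpha> F) (LpK (ereal q))"
    and "LpK_norm (ereal q) (frac_maximal \<alpha> F) \<le> ennreal C * LpK_norm (ereal p) F"
proof -
  obtain N where N: "0 \<le> N" "(\<integral>\<^sup>+ y. ennpowr (set_norm (F y)) p \<partial>lebesgue) = ennreal (N powr p)"
    "LpK_norm (ereal p) F = ennreal N"
    using LpK_normE[OF F] p(1) by (metis less_imp_le)
  have K: "Kmeasurable F" "\<And>y. F y \<in> Kbcs" using F by (auto simp: LpK_def)
  let ?M = "frac_maximal \<alpha> F" and ?H = "hl_maximal (\<lambda>y. set_norm (F y))"
  let ?K = "2 * 5 ^ CARD('n) * (p / (p - 1)) * 2 powr (p - 1)"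
  have expo: "1 - \<alpha> * p = p / q" using p \<alpha>(2) by (auto simp: field_simps)
  have pq: "0 < p / q" using p by simp
  then have ap: "\<alpha> * p < 1" using expo by linarith
  have M: "set_norm (?M x) \<le> ennpowr (?H x) (p / q) * ennreal ((2 * N) powr (\<alpha> * p))" for x
    using frac_maximal_Hedberg[OF K _ \<alpha>(1) ap N(1,2), of x] p(1) by (simp add: expo)
  have measM: "Kmeasurable ?M"
    by (intro Kmeasurable_frac_maximal zero_in_Kbcs K)
  have fin: "set_norm (F y) < \<infinity>" for y
    using K(2)[of y] bounded_iff_set_norm by (auto simp: Kbcs_def)
  let ?I = "\<integral>\<^sup>+ x. ennpowr (set_norm (?M x)) q \<partial>lebesgue"
  have "?I \<le> (\<integral>\<^sup>+ x. ennreal (((2 * N) powr (\<alpha> * p)) powr q) * ennpowr (?H x) p \<partial>lebesgue)"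
  proof (rule nn_integral_mono)
    fix x
    have "ennpowr (set_norm (?M x)) q \<le> ennpowr (ennpowr (?H x) (p / q) * ennreal ((2 * N) powr (\<alpha> * p))) q"
      using M p by (intro ennpowr_mono) auto
    also have "\<dots> = ennreal (((2 * N) powr (\<alpha> * p)) powr q) * ennpowr (?H x) p"
      using p by (subst ennpowr_mult_real) (auto simp: ennpowr_ennpowr mult.commute)
    finally show "ennpowr (set_norm (?M x)) q \<le> ennreal (((2 * N) powr (\<alpha> * p)) powr q) * ennpowr (?H x) p" .
  qed
  also have "\<dots> = ennreal (((2 * N) powr (\<alpha> * p)) powr q) * (\<integral>\<^sup>+ x. ennpowr (?H x) p \<partial>lebesgue)"
    by (intro nn_integral_cmult) measurable
  also have "\<dots> \<le> ennreal (((2 * N) powr (\<alpha> * p)) powr q) * (ennreal ?K * ennreal (N powr p))"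
    using hl_maximal_strong_bound[of "\<lambda>y. set_norm (F y)", OF borel_measurable_set_norm[OF K(1)] fin p(1)]
    unfolding N(2) by (rule mult_left_mono) simp
  also have "\<dots> = ennreal (((2 * N) powr (\<alpha> * p)) powr q * (?K * N powr p))"
    using p by (simp only: ennreal_mult powr_ge_zero mult_nonneg_nonneg divide_nonneg_nonneg
        zero_le_power zero_le_numeral less_imp_le diff_ge_0_iff_ge order_less_imp_le less_trans[OF zero_less_one])
  finally have I: "?I \<le> ennreal (((2 * N) powr (\<alpha> * p)) powr q * (?K * N powr p))" .
  have "LpK_norm (ereal q) ?M = ennpowr ?I (1 / q)" by (simp add: LpK_norm_def)
  also have "\<dots> \<le> ennpowr (ennreal (((2 * N) powr (\<alpha> * p)) powr q * (?K * N powr p))) (1 / q)"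
    using I p by (intro ennpowr_mono) auto
  also have "\<dots> = ennreal ((((2 * N) powr (\<alpha> * p)) powr q * (?K * N powr p)) powr (1 / q))"
    using p by (simp add: ennpowr_def)
  also have "(((2 * N) powr (\<alpha> * p)) powr q * (?K * N powr p)) powr (1 / q) = C * N"
  proof -
    have "(((2 * N) powr (\<alpha> * p)) powr q * (?K * N powr p)) powr (1 / q)
        = (2 * N) powr (\<alpha> * p) * (?K powr (1 / q) * N powr (p / q))"
    proof -
      have "(((2 * N) powr (\<alpha> * p)) powr q) powr (1 / q) = (2 * N) powr (\<alpha> * p)"
        using p by (simp add: powr_powr)
      moreover have "(N powr p) powr (1 / q) = N powr (p / q)" by (simp add: powr_powr)
      ultimately show ?thesis by (simp only: powr_mult)
    qed
    also have "\<dots> = C * (N powr (\<alpha> * p) * N powr (p / q))"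
      by (simp add: C_def powr_mult)
    also have "N powr (\<alpha> * p) * N powr (p / q) = N"
    proof -
      have "\<alpha> * p + p / q = 1" using expo by linarith
      then show ?thesis using N(1) by (simp add: powr_add[symmetric])
    qed
    finally show ?thesis .
  qed
  finally have le: "LpK_norm (ereal q) ?M \<le> ennreal (C * N)" .
  have "0 \<le> C" by (simp add: C_def)
  then show "LpK_norm (ereal q) ?M \<le> ennreal C * LpK_norm (ereal p) F"
    using le N(1) by (simp add: N(3) ennreal_mult)
  have "AE x in lebesgue. ennpowr (set_norm (?M x)) q \<noteq> \<infinity>"
  proof (rule nn_integral_PInf_AE)
    show "(\<lambda>x. ennpowr (set_norm (?M x)) q) \<in> borel_measurable lebesgue"
      using borel_measurable_set_norm[OF measM] by measurable
    show "?I \<noteq> \<infinity>" using I by (auto simp: top_unique)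
  qed
  then have "AE x in lebesgue. set_norm (?M x) < \<infinity>"
    by (auto simp: less_top elim!: eventually_mono)
  then obtain G where G: "\<forall>x. G x \<in> Kbcs" "Kmeasurable G" "AE x in lebesgue. ?M x = G x"
    "\<forall>x. set_norm (G x) \<le> set_norm (?M x)"
    using frac_maximal_ae_Kbcs[of F, OF K(2)] by blast
  have "LpK_norm (ereal q) G \<le> LpK_norm (ereal q) ?M"
    using p by (intro LpK_norm_mono[OF G(2) G(4)[rule_format]]) simp
  then have "LpK_norm (ereal q) G < \<infinity>"
    using le_less_trans[OF order_trans[OF _ le] ennreal_less_top] by simp
  then have "G \<in> LpK (ereal q)"
    using G(1,2) by (simp add: LpK_def)
  then show "ae_member ?M (LpK (ereal q))"
    using G(3) unfolding ae_member_def by blast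
qed

text \<open>The set of infinite magnitude lies in every level set, so every multiple of a power of
  its measure is bounded by the weak norm.\<close>

lemma AE_finite_if_weak:
  assumes H: "Kmeasurable H" and p: "0 < p" and fin: "weak_LpK_norm p H < \<infinity>"
  shows "AE x in lebesgue. set_norm (H x) < \<infinity>"
proof -
  let ?T = "{x. set_norm (H x) = top}"
  have T: "?T \<in> sets lebesgue"
    using borel_measurable_eq[OF borel_measurable_set_norm[OF H] borel_measurable_const[of top]] by simp
  have S: "{x. ennreal l < set_norm (H x)} \<in> sets lebesgue" for l
    using borel_measurable_less[OF borel_measurable_const[of "ennreal l"] borel_measurable_set_norm[OF H]]
    by simp
  obtain c where c: "0 \<le> c" "weak_LpK_norm p H = ennreal c"
    using fin by (cases "weak_LpK_norm p H") auto
  have le: "ennreal l * ennpowr (emeasure lebesgue ?T) (1 / p) \<le> ennreal c" if "0 < l" for l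
  proof -
    have "ennreal l * ennpowr (emeasure lebesgue ?T) (1 / p)
        \<le> ennreal l * ennpowr (emeasure lebesgue {x. ennreal l < set_norm (H x)}) (1 / p)"
      using S p by (intro mult_left_mono ennpowr_mono emeasure_mono) auto
    also have "\<dots> \<le> weak_LpK_norm p H"
      unfolding weak_LpK_norm_def using that by (intro SUP_upper) auto
    finally show ?thesis by (simp add: c)
  qed
  have "ennpowr (emeasure lebesgue ?T) (1 / p) = 0"
  proof (rule ccontr)
    assume nz: "ennpowr (emeasure lebesgue ?T) (1 / p) \<noteq> 0"
    have "ennpowr (emeasure lebesgue ?T) (1 / p) \<noteq> top"
      using le[of 1] by (auto simp: top_unique simp del: ennpowr_eq_top_iff)
    then obtain r where r: "0 < r" "ennpowr (emeasure lebesgue ?T) (1 / p) = ennreal r"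
      using nz by (cases "ennpowr (emeasure lebesgue ?T) (1 / p)") (auto simp: less_le)
    \<comment> \<open>The level (c + 1)/r is chosen to give c + 1 \<le> c.\<close>
    then have "(c + 1) / r * r \<le> c"
      using le[of "(c + 1) / r"] c by (simp add: ennreal_mult[symmetric])
    then show False using r by simp
  qed
  then have "emeasure lebesgue ?T = 0"
    by (cases "emeasure lebesgue ?T") (auto simp: ennpowr_def split: if_splits)
  then have "?T \<in> null_sets lebesgue" using T by blast
  then show ?thesis by (rule AE_I') (auto simp: not_less top_unique)
qed

text \<open>Hedberg's bound with p = 1 places each level set of the magnitude inside one of the
  Hardy--Littlewood function, and the weak (1,1) bound is raised to the power 1 - \<alpha> = 1/q.
  The factor 2^\<alpha> comes from (2N)^\<alpha>, the rest of \<open>C\<close> from the covering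
  constant.\<close>

lemma frac_maximal_weak:
  fixes F :: "real ^ 'n \<Rightarrow> (real ^ 'd) set"
  assumes \<alpha>: "0 < \<alpha>" "\<alpha> < 1" and F: "F \<in> LpK 1"
  defines "C \<equiv> 2 powr \<alpha> * (5 ^ CARD('n)) powr (1 - \<alpha>)"
  shows "ae_member (frac_maximal \<alpha> F) (weak_LpK (1 / (1 - \<alpha>)))"
    and "weak_LpK_norm (1 / (1 - \<alpha>)) (frac_maximal \<alpha> F) \<le> ennreal C * LpK_norm 1 F"
proof -
  obtain N where N: "0 \<le> N" "(\<integral>\<^sup>+ y. ennpowr (set_norm (F y)) 1 \<partial>lebesgue) = ennreal (N powr 1)"
    "LpK_norm 1 F = ennreal N"
    using LpK_normE[of F 1] F by (auto simp: one_ereal_def)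
  have K: "Kmeasurable F" "\<And>y. F y \<in> Kbcs" using F by (auto simp: LpK_def)
  let ?M = "frac_maximal \<alpha> F" and ?H = "hl_maximal (\<lambda>y. set_norm (F y))"
  have M: "set_norm (?M x) \<le> ennpowr (?H x) (1 - \<alpha>) * ennreal ((2 * N) powr \<alpha>)" for x
    using frac_maximal_Hedberg[OF K order_refl \<alpha>(1) _ N(1,2), of x] \<alpha> by simp
  have measM: "Kmeasurable ?M"
    by (intro Kmeasurable_frac_maximal zero_in_Kbcs K)
  have "ennpowr a 1 = a" for a by (cases a) (auto simp: ennpowr_def)
  then have int: "(\<integral>\<^sup>+ y. set_norm (F y) \<partial>lebesgue) = ennreal N" using N by simp
  have level: "ennreal l * ennpowr (emeasure lebesgue {x. ennreal l < set_norm (?M x)}) (1 - \<alpha>) \<le> ennreal (C * N)"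
    if l: "0 < l" for l
  proof (cases "N = 0")
    case True
    then have "set_norm (?M x) = 0" for x using M[of x] by simp
    then show ?thesis using \<alpha> by (simp add: ennpowr_def)
  next
    case False
    then have pos: "0 < N" using N(1) by simp
    \<comment> \<open>This t solves t^(1 - \<alpha>) (2N)^\<alpha> = l: it is the level of the
      Hardy--Littlewood function at which Hedberg's bound equals l. Dividing by (2N)^\<alpha> is why
      N = 0 was split off.\<close>
    define t where "t = (l / (2 * N) powr \<alpha>) powr (1 / (1 - \<alpha>))"
    have t: "0 < t" "t powr (1 - \<alpha>) = l / (2 * N) powr \<alpha>"
      using l pos \<alpha> by (simp_all add: t_def powr_powr)
    have sub: "{x. ennreal l < set_norm (?M x)} \<subseteq> {x. ennreal t < ?H x}"
    proof safe
      fix x assume x: "ennreal l < set_norm (?M x)"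
      show "ennreal t < ?H x"
      proof (rule ccontr)
        assume "\<not> ?thesis"
        then have "set_norm (?M x) \<le> ennpowr (ennreal t) (1 - \<alpha>) * ennreal ((2 * N) powr \<alpha>)"
          using \<alpha> by (intro order_trans[OF M] mult_right_mono ennpowr_mono) auto
        also have "\<dots> = ennreal l"
          using t pos l by (simp add: ennpowr_def ennreal_mult[symmetric])
        finally show False using x by simp
      qed
    qed
    have weak: "ennreal t * emeasure lebesgue {x. ennreal t < ?H x} \<le> ennreal (5 ^ CARD('n) * N)"
      using hl_maximal_weak_bound[OF borel_measurable_set_norm[OF K(1)] t(1)] N(1) ennreal_power[of 5 "CARD('n)"]
      by (simp add: int ennreal_mult)
    have sub: "emeasure lebesgue {x. ennreal l < set_norm (?M x)} \<le> emeasure lebesgue {x. ennreal t < ?H x}"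
      using sub open_hl_maximal[of t "\<lambda>y. set_norm (F y)"] t(1) by (intro emeasure_mono) auto
    have E: "ennreal t * emeasure lebesgue {x. ennreal l < set_norm (?M x)} \<le> ennreal (5 ^ CARD('n) * N)"
      by (rule order_trans[OF mult_left_mono[OF sub] weak]) simp
    have "emeasure lebesgue {x. ennreal l < set_norm (?M x)} \<noteq> top"
    proof
      assume "emeasure lebesgue {x. ennreal l < set_norm (?M x)} = top"
      then show False using E t(1) by (simp add: ennreal_mult_top top_unique)
    qed
    then obtain m where m: "0 \<le> m" "emeasure lebesgue {x. ennreal l < set_norm (?M x)} = ennreal m"
      by (cases "emeasure lebesgue {x. ennreal l < set_norm (?M x)}") auto
    have "t * m \<le> 5 ^ CARD('n) * N"
      using E t(1) m N(1) by (simp add: ennreal_mult[symmetric])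
    then have "(t * m) powr (1 - \<alpha>) \<le> (5 ^ CARD('n) * N) powr (1 - \<alpha>)"
      using \<alpha> t(1) m by (intro powr_mono2) auto
    then have "l / (2 * N) powr \<alpha> * m powr (1 - \<alpha>) \<le> (5 ^ CARD('n)) powr (1 - \<alpha>) * N powr (1 - \<alpha>)"
      by (simp add: powr_mult t(2))
    then have "l * m powr (1 - \<alpha>) \<le> (2 * N) powr \<alpha> * ((5 ^ CARD('n)) powr (1 - \<alpha>) * N powr (1 - \<alpha>))"
      using pos by (simp add: field_simps)
    also have "\<dots> = C * (N powr \<alpha> * N powr (1 - \<alpha>))"
      by (simp add: C_def powr_mult)
    also have "N powr \<alpha> * N powr (1 - \<alpha>) = N"
      using N(1) by (simp add: powr_add[symmetric])
    finally show ?thesis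
      using l m by (simp add: ennpowr_def ennreal_mult[symmetric] ennreal_leI)
  qed
  have le: "weak_LpK_norm (1 / (1 - \<alpha>)) ?M \<le> ennreal (C * N)"
    unfolding weak_LpK_norm_def using level by (intro SUP_least) simp
  have "0 \<le> C" by (simp add: C_def)
  then show "weak_LpK_norm (1 / (1 - \<alpha>)) ?M \<le> ennreal C * LpK_norm 1 F"
    using le N(1) by (simp add: N(3) ennreal_mult)
  have "AE x in lebesgue. set_norm (?M x) < \<infinity>"
    using le_less_trans[OF le ennreal_less_top] \<alpha>
    by (intro AE_finite_if_weak[OF measM, of "1 / (1 - \<alpha>)"]) simp_all
  then obtain G where G: "\<forall>x. G x \<in> Kbcs" "Kmeasurable G" "AE x in lebesgue. ?M x = G x"
    "\<forall>x. set_norm (G x) \<le> set_norm (?M x)"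
    using frac_maximal_ae_Kbcs[of F, OF K(2)] by blast
  have "weak_LpK_norm (1 / (1 - \<alpha>)) G \<le> weak_LpK_norm (1 / (1 - \<alpha>)) ?M"
    using \<alpha> by (intro weak_LpK_norm_mono[OF measM G(4)[rule_format]]) simp
  then have "weak_LpK_norm (1 / (1 - \<alpha>)) G < \<infinity>"
    using le_less_trans[OF order_trans[OF _ le] ennreal_less_top] by simp
  then have "G \<in> weak_LpK (1 / (1 - \<alpha>))"
    using G(1,2) by (simp add: weak_LpK_def)
  then show "ae_member ?M (weak_LpK (1 / (1 - \<alpha>)))"
    using G(3) unfolding ae_member_def by blast
qed

theorem theorem3p3:
  fixes \<alpha> :: real
  assumes "0 < \<alpha>" and "\<alpha> < 1"
  shows
    "(\<forall>p q :: ereal. 1 < p \<and> p < q \<and> q \<le> \<infinity> \<and> 1 / p - 1 / q = ereal \<alpha> \<longrightarrow>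
        (\<exists>C::real. 0 \<le> C \<and>
           (\<forall>F \<in> (LpK p :: (real ^ 'n \<Rightarrow> (real ^ 'd) set) set).
              ae_member (frac_maximal \<alpha> F) (LpK q) \<and>
              LpK_norm q (frac_maximal \<alpha> F) \<le> ennreal C * LpK_norm p F))) \<and>
     (\<exists>C::real. 0 \<le> C \<and>
        (\<forall>F \<in> (LpK 1 :: (real ^ 'n \<Rightarrow> (real ^ 'd) set) set).
           ae_member (frac_maximal \<alpha> F) (weak_LpK (1 / (1 - \<alpha>))) \<and>
           weak_LpK_norm (1 / (1 - \<alpha>)) (frac_maximal \<alpha> F) \<le> ennreal C * LpK_norm 1 F))"
proof (intro conjI allI impI)
  fix p q :: ereal
  assume pq: "1 < p \<and> p < q \<and> q \<le> \<infinity> \<and> 1 / p - 1 / q = ereal \<alpha>"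
  then obtain p' where p': "p = ereal p'" "1 < p'" by (cases p) auto
  show "\<exists>C::real. 0 \<le> C \<and>
      (\<forall>F \<in> (LpK p :: (real ^ 'n \<Rightarrow> (real ^ 'd) set) set).
        ae_member (frac_maximal \<alpha> F) (LpK q) \<and>
        LpK_norm q (frac_maximal \<alpha> F) \<le> ennreal C * LpK_norm p F)"
  proof (cases q)
    case (real q')
    then have "p' < q'" "1 / p' - 1 / q' = \<alpha>" using pq p' by (auto simp: divide_ereal_def inverse_eq_divide)
    then show ?thesis
      using frac_maximal_strong[of p' q' \<alpha>] assms p' real
      by (intro exI[of _ "2 powr (\<alpha> * p') * (2 * 5 ^ CARD('n) * (p' / (p' - 1)) * 2 powr (p' - 1)) powr (1 / q')"])
        auto
  next
    case PInf
    \<comment> \<open>In the extended reals 1/q is 0 for infinite q, so this is the endpoint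
      \<alpha> p = 1.\<close>
    then have "\<alpha> = 1 / p'" using pq p' by (simp add: divide_ereal_def inverse_eq_divide)
    then show ?thesis
      using frac_maximal_L_infinity[of p'] p' PInf by (intro exI[of _ 2]) auto
  qed (use pq in auto)
next
  show "\<exists>C::real. 0 \<le> C \<and>
      (\<forall>F \<in> (LpK 1 :: (real ^ 'n \<Rightarrow> (real ^ 'd) set) set).
        ae_member (frac_maximal \<alpha> F) (weak_LpK (1 / (1 - \<alpha>))) \<and>
        weak_LpK_norm (1 / (1 - \<alpha>)) (frac_maximal \<alpha> F) \<le> ennreal C * LpK_norm 1 F)"
    using frac_maximal_weak[OF assms]
    by (intro exI[of _ "2 powr \<alpha> * (5 ^ CARD('n)) powr (1 - \<alpha>)"]) auto
qed

end
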